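(* Let $G$ be a Barnette graph whose faces are properly $3$-colored with colors $\{1,2,3\}$, where the outer face of $G$ is a $3$-face. The following are equivalent: (i) $G$ has a hamiltonian cycle $C$ such that all $2$-faces lie inside $C$, all $3$-faces lie outside $C$ (and $1$-faces may lie on either side); (ii) the reduced graph $H$ obtained from $G$ by contracting the $1$-faces has an $A$-trail; (iii) the reduced graph $H'$ obtained from $G$ by contracting the $2$-faces has a spanning tree of faces all of whose faces are $1$-faces; (iv) the reduced graph $H''$ obtained from $G$ by contracting the $3$-faces has a spanning tree of faces all of whose faces are $1$-faces.
   Context: A Barnette graph is a $3$-connected cubic planar bipartite graph (here with a fixed plane embedding). Such a graph has a proper $3$-face-coloring; faces of color $i$ are called $i$-faces, and the boundaries of the $i$-faces form a facial $2$-factor (a spanning $2$-regular subgraph whose cycles are face boundaries). Contracting the $i$-faces means contracting each boundary cycle of an $i$-face to a single vertex, producing a plane multigraph (the reduced graph) whose faces correspond to the faces of $G$ of the other two colors; these faces retain their colors. An $A$-trail of a $2$-connected eulerian plane graph is an eulerian trail in which any two consecutive edges lie on a common face boundary. Radial graph: for a $2$-connected plane graph $H$ with face set $\mathcal{F}(H)$, $\mathcal{R}(H)$ is the bipartite graph on $V(H)\cup\mathcal{F}(H)$ with $x$ adjacent to face $F$ iff $x$ lies on the boundary of $F$. Spanning tree of faces: if $\mathcal{T}$ is a set of bounded faces of $H$ with pairwise edge-disjoint boundaries covering all vertices, and the subgraph of $\mathcal{R}(H)$ induced by $V(H)\cup\mathcal{T}$ is a tree, then the subgraph $H_{\mathcal{T}}$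 formed by the boundary edges of faces of $\mathcal{T}$ is a spanning tree of faces. *)

theory Defs
  imports "HOL-Combinatorics.Permutations" "HOL-Combinatorics.Orbits"
begin

section \<open>Plane (multi)graphs as combinatorial maps\<close>

text \<open>A plane graph is given by a combinatorial map on a finite set of darts D:
  alpha is a fixed-point-free involution (the two darts of an edge), sigma the
  rotation (cyclic order of darts around a vertex). Vertices are sigma-orbits,
  edges are alpha-orbits, faces are orbits of sigma o alpha. Genus 0
  (Euler formula) means the map is a sphere embedding; a designated face
  plays the role of the outer (unbounded) face.\<close>

definition vertex_of :: "('d \<Rightarrow> 'd) \<Rightarrow> 'd \<Rightarrow> 'd set" where
  "vertex_of \<sigma> d = orbit \<sigma> d"

definition edge_of :: "('d \<Rightarrow> 'd) \<Rightarrow> 'd \<Rightarrow> 'd set" where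
  "edge_of \<alpha> d = {d, \<alpha> d}"

definition face_of :: "('d \<Rightarrow> 'd) \<Rightarrow> ('d \<Rightarrow> 'd) \<Rightarrow> 'd \<Rightarrow> 'd set" where
  "face_of \<alpha> \<sigma> d = orbit (\<sigma> \<circ> \<alpha>) d"

definition map_verts :: "'d set \<Rightarrow> ('d \<Rightarrow> 'd) \<Rightarrow> 'd set set" where
  "map_verts D \<sigma> = vertex_of \<sigma> ` D"

definition map_edges :: "'d set \<Rightarrow> ('d \<Rightarrow> 'd) \<Rightarrow> 'd set set" where
  "map_edges D \<alpha> = edge_of \<alpha> ` D"

definition map_faces :: "'d set \<Rightarrow> ('d \<Rightarrow> 'd) \<Rightarrow> ('d \<Rightarrow> 'd) \<Rightarrow> 'd set set" where
  "map_faces D \<alpha> \<sigma> = face_of \<alpha> \<sigma> ` D"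

definition comb_map :: "'d set \<Rightarrow> ('d \<Rightarrow> 'd) \<Rightarrow> ('d \<Rightarrow> 'd) \<Rightarrow> bool" where
  "comb_map D \<alpha> \<sigma> \<longleftrightarrow> finite D \<and> D \<noteq> {} \<and> \<alpha> permutes D \<and> \<sigma> permutes D
     \<and> (\<forall>d\<in>D. \<alpha> (\<alpha> d) = d \<and> \<alpha> d \<noteq> d)"

definition map_connected :: "'d set \<Rightarrow> ('d \<Rightarrow> 'd) \<Rightarrow> ('d \<Rightarrow> 'd) \<Rightarrow> bool" where
  "map_connected D \<alpha> \<sigma> \<longleftrightarrow>
     (\<forall>d\<in>D. \<forall>d'\<in>D. (d, d') \<in> {(x, y). x \<in> D \<and> (y = \<alpha> x \<or> y = \<sigma> x)}\<^sup>*)"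

definition plane_map :: "'d set \<Rightarrow> ('d \<Rightarrow> 'd) \<Rightarrow> ('d \<Rightarrow> 'd) \<Rightarrow> bool" where
  "plane_map D \<alpha> \<sigma> \<longleftrightarrow> comb_map D \<alpha> \<sigma> \<and> map_connected D \<alpha> \<sigma> \<and>
     int (card (map_verts D \<sigma>)) - int (card (map_edges D \<alpha>))
       + int (card (map_faces D \<alpha> \<sigma>)) = 2"

section \<open>Simple graphs given by an adjacency predicate on a vertex set\<close>

definition sg_connected :: "'v set \<Rightarrow> ('v \<Rightarrow> 'v \<Rightarrow> bool) \<Rightarrow> bool" where
  "sg_connected W adj \<longleftrightarrow>
     (\<forall>u\<in>W. \<forall>w\<in>W. (u, w) \<in> {(a, b). a \<in> W \<and> b \<in> W \<and> adj a b}\<^sup>*)"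

definition sg_acyclic :: "'v set \<Rightarrow> ('v \<Rightarrow> 'v \<Rightarrow> bool) \<Rightarrow> bool" where
  "sg_acyclic W adj \<longleftrightarrow>
     \<not> (\<exists>cyc. length cyc \<ge> 3 \<and> distinct cyc \<and> set cyc \<subseteq> W \<and>
          (\<forall>i<length cyc. adj (cyc ! i) (cyc ! ((i + 1) mod length cyc))))"

definition sg_tree :: "'v set \<Rightarrow> ('v \<Rightarrow> 'v \<Rightarrow> bool) \<Rightarrow> bool" where
  "sg_tree W adj \<longleftrightarrow> W \<noteq> {} \<and> sg_connected W adj \<and> sg_acyclic W adj"

section \<open>Barnette graphs\<close>

text \<open>Adjacency of vertices (sigma-orbits) in the underlying graph.\<close>
definition map_vadj :: "('d \<Rightarrow> 'd) \<Rightarrow> ('d \<Rightarrow> 'd) \<Rightarrow> 'd set \<Rightarrow> 'd set \<Rightarrow> bool" where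
  "map_vadj \<alpha> \<sigma> u w \<longleftrightarrow> (\<exists>d\<in>u. vertex_of \<sigma> (\<alpha> d) = w)"

definition map_simple :: "'d set \<Rightarrow> ('d \<Rightarrow> 'd) \<Rightarrow> ('d \<Rightarrow> 'd) \<Rightarrow> bool" where
  "map_simple D \<alpha> \<sigma> \<longleftrightarrow>
     (\<forall>d\<in>D. vertex_of \<sigma> (\<alpha> d) \<noteq> vertex_of \<sigma> d) \<and>
     (\<forall>d\<in>D. \<forall>d'\<in>D. vertex_of \<sigma> d = vertex_of \<sigma> d' \<and>
         vertex_of \<sigma> (\<alpha> d) = vertex_of \<sigma> (\<alpha> d') \<longrightarrow> d = d')"

definition map_cubic :: "'d set \<Rightarrow> ('d \<Rightarrow> 'd) \<Rightarrow> bool" where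
  "map_cubic D \<sigma> \<longleftrightarrow> (\<forall>d\<in>D. card (vertex_of \<sigma> d) = 3)"

definition map_bipartite :: "'d set \<Rightarrow> ('d \<Rightarrow> 'd) \<Rightarrow> ('d \<Rightarrow> 'd) \<Rightarrow> bool" where
  "map_bipartite D \<alpha> \<sigma> \<longleftrightarrow>
     (\<exists>c :: 'd set \<Rightarrow> bool. \<forall>d\<in>D. c (vertex_of \<sigma> d) \<noteq> c (vertex_of \<sigma> (\<alpha> d)))"

definition map_3_connected :: "'d set \<Rightarrow> ('d \<Rightarrow> 'd) \<Rightarrow> ('d \<Rightarrow> 'd) \<Rightarrow> bool" where
  "map_3_connected D \<alpha> \<sigma> \<longleftrightarrow> card (map_verts D \<sigma>) \<ge> 4 \<and>
     (\<forall>S \<subseteq> map_verts D \<sigma>. card S \<le> 2 \<longrightarrow>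
        sg_connected (map_verts D \<sigma> - S) (map_vadj \<alpha> \<sigma>))"

definition barnette :: "'d set \<Rightarrow> ('d \<Rightarrow> 'd) \<Rightarrow> ('d \<Rightarrow> 'd) \<Rightarrow> bool" where
  "barnette D \<alpha> \<sigma> \<longleftrightarrow> plane_map D \<alpha> \<sigma> \<and> map_simple D \<alpha> \<sigma> \<and> map_cubic D \<sigma> \<and>
     map_bipartite D \<alpha> \<sigma> \<and> map_3_connected D \<alpha> \<sigma>"

definition proper_face_3_coloring ::
  "'d set \<Rightarrow> ('d \<Rightarrow> 'd) \<Rightarrow> ('d \<Rightarrow> 'd) \<Rightarrow> ('d set \<Rightarrow> nat) \<Rightarrow> bool" where
  "proper_face_3_coloring D \<alpha> \<sigma> col \<longleftrightarrow>
     (\<forall>F\<in>map_faces D \<alpha> \<sigma>. col F \<in> {1, 2, 3}) \<and>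
     (\<forall>d\<in>D. col (face_of \<alpha> \<sigma> d) \<noteq> col (face_of \<alpha> \<sigma> (\<alpha> d)))"

section \<open>Hamiltonian cycles and their sides\<close>

definition ham_cycle :: "'d set \<Rightarrow> ('d \<Rightarrow> 'd) \<Rightarrow> ('d \<Rightarrow> 'd) \<Rightarrow> 'd set set \<Rightarrow> bool" where
  "ham_cycle D \<alpha> \<sigma> C \<longleftrightarrow> C \<subseteq> map_edges D \<alpha> \<and>
     (\<forall>v\<in>map_verts D \<sigma>. card {e\<in>C. e \<inter> v \<noteq> {}} = 2) \<and>
     sg_connected (map_verts D \<sigma>) (\<lambda>u w. u \<noteq> w \<and> (\<exists>e\<in>C. e \<inter> u \<noteq> {} \<and> e \<inter> w \<noteq> {}))"

text \<open>Faces lying outside the cycle C: those reachable from the outer face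
  in the dual graph without crossing an edge of C.\<close>
definition outside_faces ::
  "'d set \<Rightarrow> ('d \<Rightarrow> 'd) \<Rightarrow> ('d \<Rightarrow> 'd) \<Rightarrow> 'd set set \<Rightarrow> 'd set \<Rightarrow> 'd set set" where
  "outside_faces D \<alpha> \<sigma> C outer =
     {F. (outer, F) \<in> {(F1, F2). \<exists>d\<in>D. face_of \<alpha> \<sigma> d = F1 \<and>
          face_of \<alpha> \<sigma> (\<alpha> d) = F2 \<and> edge_of \<alpha> d \<notin> C}\<^sup>*}"

section \<open>Abstract plane multigraphs with faces: A-trails and spanning trees of faces\<close>

text \<open>V vertices, E edges, ends e = set of end vertices of e (one element for a
  loop), Fs faces, fe f e: e lies on the boundary of f, fv f v: v lies on the
  boundary of f.\<close>

definition is_A_trail ::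
  "'v set \<Rightarrow> 'e set \<Rightarrow> ('e \<Rightarrow> 'v set) \<Rightarrow> 'f set \<Rightarrow> ('f \<Rightarrow> 'e \<Rightarrow> bool)
    \<Rightarrow> 'e list \<Rightarrow> 'v list \<Rightarrow> bool" where
  "is_A_trail V E ends Fs fe es vs \<longleftrightarrow>
     (let m = length es in
        m > 0 \<and> length vs = m \<and> distinct es \<and> set es = E \<and> set vs \<subseteq> V \<and>
        (\<forall>i<m. ends (es ! i) = {vs ! i, vs ! ((i + 1) mod m)}) \<and>
        (\<forall>i<m. \<exists>f\<in>Fs. fe f (es ! i) \<and> fe f (es ! ((i + 1) mod m))))"

definition has_A_trail ::
  "'v set \<Rightarrow> 'e set \<Rightarrow> ('e \<Rightarrow> 'v set) \<Rightarrow> 'f set \<Rightarrow> ('f \<Rightarrow> 'e \<Rightarrow> bool) \<Rightarrow> bool" where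
  "has_A_trail V E ends Fs fe \<longleftrightarrow> (\<exists>es vs. is_A_trail V E ends Fs fe es vs)"

definition radial_adj :: "('f \<Rightarrow> 'v \<Rightarrow> bool) \<Rightarrow> ('v + 'f) \<Rightarrow> ('v + 'f) \<Rightarrow> bool" where
  "radial_adj fv x y = (case (x, y) of
       (Inl v, Inr f) \<Rightarrow> fv f v
     | (Inr f, Inl v) \<Rightarrow> fv f v
     | _ \<Rightarrow> False)"

definition is_spanning_tree_of_faces ::
  "'v set \<Rightarrow> 'f set \<Rightarrow> ('f \<Rightarrow> 'e \<Rightarrow> bool) \<Rightarrow> ('f \<Rightarrow> 'v \<Rightarrow> bool) \<Rightarrow> 'f \<Rightarrow> 'f set \<Rightarrow> bool" where
  "is_spanning_tree_of_faces V Fs fe fv outer T \<longleftrightarrow>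
     T \<subseteq> Fs - {outer} \<and>
     (\<forall>f\<in>T. \<forall>f'\<in>T. f \<noteq> f' \<longrightarrow> \<not> (\<exists>e. fe f e \<and> fe f' e)) \<and>
     (\<forall>v\<in>V. \<exists>f\<in>T. fv f v) \<and>
     sg_tree (Inl ` V \<union> Inr ` T) (radial_adj fv)"

section \<open>The reduced graph obtained by contracting the i-faces\<close>

text \<open>Vertices: the i-faces of G; edges: the edges of G not on the boundary of
  any i-face; the ends of such an edge are the i-faces through its end
  vertices; faces: the faces of G of the other two colours, keeping the
  remaining (uncontracted) edges on their boundary; a contracted i-face X lies on the
  boundary of a face F iff F and X share a vertex of G.\<close>

definition red_verts :: "'d set \<Rightarrow> ('d \<Rightarrow> 'd) \<Rightarrow> ('d \<Rightarrow> 'd) \<Rightarrow> ('d set \<Rightarrow> nat) \<Rightarrow> nat \<Rightarrow> 'd set set" where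
  "red_verts D \<alpha> \<sigma> col i = {F\<in>map_faces D \<alpha> \<sigma>. col F = i}"

definition red_edges :: "'d set \<Rightarrow> ('d \<Rightarrow> 'd) \<Rightarrow> ('d \<Rightarrow> 'd) \<Rightarrow> ('d set \<Rightarrow> nat) \<Rightarrow> nat \<Rightarrow> 'd set set" where
  "red_edges D \<alpha> \<sigma> col i =
     {e\<in>map_edges D \<alpha>. \<forall>F\<in>map_faces D \<alpha> \<sigma>. col F = i \<longrightarrow> e \<inter> F = {}}"

definition red_ends :: "'d set \<Rightarrow> ('d \<Rightarrow> 'd) \<Rightarrow> ('d \<Rightarrow> 'd) \<Rightarrow> ('d set \<Rightarrow> nat) \<Rightarrow> nat \<Rightarrow> 'd set \<Rightarrow> 'd set set" where
  "red_ends D \<alpha> \<sigma> col i e =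
     {X\<in>red_verts D \<alpha> \<sigma> col i. \<exists>d\<in>e. X \<inter> vertex_of \<sigma> d \<noteq> {}}"

definition red_faces :: "'d set \<Rightarrow> ('d \<Rightarrow> 'd) \<Rightarrow> ('d \<Rightarrow> 'd) \<Rightarrow> ('d set \<Rightarrow> nat) \<Rightarrow> nat \<Rightarrow> 'd set set" where
  "red_faces D \<alpha> \<sigma> col i = {F\<in>map_faces D \<alpha> \<sigma>. col F \<noteq> i}"

definition red_fe :: "'d set \<Rightarrow> ('d \<Rightarrow> 'd) \<Rightarrow> ('d \<Rightarrow> 'd) \<Rightarrow> ('d set \<Rightarrow> nat) \<Rightarrow> nat \<Rightarrow> 'd set \<Rightarrow> 'd set \<Rightarrow> bool" where
  "red_fe D \<alpha> \<sigma> col i F e \<longleftrightarrow> e \<in> red_edges D \<alpha> \<sigma> col i \<and> e \<inter> F \<noteq> {}"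

definition red_fv :: "'d set \<Rightarrow> ('d \<Rightarrow> 'd) \<Rightarrow> 'd set \<Rightarrow> 'd set \<Rightarrow> bool" where
  "red_fv D \<sigma> F X \<longleftrightarrow> (\<exists>d\<in>D. vertex_of \<sigma> d \<inter> F \<noteq> {} \<and> vertex_of \<sigma> d \<inter> X \<noteq> {})"

definition reduced_has_A_trail :: "'d set \<Rightarrow> ('d \<Rightarrow> 'd) \<Rightarrow> ('d \<Rightarrow> 'd) \<Rightarrow> ('d set \<Rightarrow> nat) \<Rightarrow> nat \<Rightarrow> bool" where
  "reduced_has_A_trail D \<alpha> \<sigma> col i \<longleftrightarrow>
     has_A_trail (red_verts D \<alpha> \<sigma> col i) (red_edges D \<alpha> \<sigma> col i) (red_ends D \<alpha> \<sigma> col i)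
       (red_faces D \<alpha> \<sigma> col i) (red_fe D \<alpha> \<sigma> col i)"

text \<open>The reduced graph (contracting the i-faces) has a spanning tree of faces
  all of whose faces have colour j; bounded = different from the outer face of G.\<close>
definition reduced_has_sptf :: "'d set \<Rightarrow> ('d \<Rightarrow> 'd) \<Rightarrow> ('d \<Rightarrow> 'd) \<Rightarrow> ('d set \<Rightarrow> nat) \<Rightarrow> 'd set \<Rightarrow> nat \<Rightarrow> nat \<Rightarrow> bool" where
  "reduced_has_sptf D \<alpha> \<sigma> col outer i j \<longleftrightarrow>
     (\<exists>T. is_spanning_tree_of_faces (red_verts D \<alpha> \<sigma> col i) (red_faces D \<alpha> \<sigma> col i)
            (red_fe D \<alpha> \<sigma> col i) (red_fv D \<sigma>) outer T \<and> (\<forall>F\<in>T. col F = j))"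

end

theory Submission
  imports Defs
begin

text \<open>All four conditions say that for some set \<open>T\<close> of 1-faces the boundary of the region formed by the
  2-faces and \<open>T\<close> is connected: this boundary contains every edge between a 2-face and a 3-face and, on
  each 1-face, every second edge, so it is 2-regular. Condition (iv) arises by passing to the
  complementary region. If the boundary is a single cycle, then walking along it shows that the dual
  graphs of both sides are connected, and Euler's formula leaves just enough edges for two trees.
  Conversely, for a tree of faces, a set of vertices closed under the boundary is cut by an even set of
  tree edges, which must be empty. 3-connectedness enters through the fact that two faces share at most
  one edge, which makes the radial graph and the corners of the reduced graphs unambiguous.\<close>

text \<open>Genus 0 enters only through Euler's formula; inside and outside are regions of faces, so
  no Jordan curve theorem appears. Everything is counted in darts, so an edge counts twice. Let a
  region have f faces and n interior darts, and its complement f' and n'. The boundary takes two of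
  the three darts at each vertex, so n + n' is the number of vertices, and Euler's formula rewrites
  this as n + n' = (2f - 2) + (2f' - 2). Connected duals on both sides give the two inequalities n
  >= 2f - 2 and n' >= 2f' - 2, which must therefore both be equalities. The radial graph and the
  A-trail record only that two faces meet, not where. A double edge of the dual is a cycle that a
  search for cycles with three or more vertices overlooks, and a trail only names a common face of
  consecutive edges, not the corner that it passes. These are the two places where a second common
  edge of two faces would do harm.\<close>

section \<open>Multigraphs given by a fixed-point-free involution\<close>

text \<open>The edges are the pairs \<open>{d, \<alpha> d}\<close>, and \<open>p\<close> sends a dart to the vertex it starts from.
  Taking \<open>p\<close> to be \<^const>\<open>vertex_of\<close> or \<^const>\<open>face_of\<close> yields the graph of a combinatorial
  map or its dual.\<close>

definition dart_rel :: "('d \<Rightarrow> 'd) \<Rightarrow> ('d \<Rightarrow> 'v) \<Rightarrow> 'd set \<Rightarrow> ('v \<times> 'v) set" where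
  "dart_rel \<alpha> p B = {(p d, p (\<alpha> d)) | d. d \<in> B}"

definition dart_connected :: "('d \<Rightarrow> 'd) \<Rightarrow> ('d \<Rightarrow> 'v) \<Rightarrow> 'd set \<Rightarrow> 'v set \<Rightarrow> bool" where
  "dart_connected \<alpha> p B V \<longleftrightarrow> (\<forall>u\<in>V. \<forall>v\<in>V. (u, v) \<in> (dart_rel \<alpha> p B)\<^sup>*)"

text \<open>Acyclicity for multigraphs: a loop, or one of two parallel edges, is never a bridge,
  whereas \<open>sg_acyclic\<close> sees only cycles with at least three vertices.\<close>

definition all_bridges :: "('d \<Rightarrow> 'd) \<Rightarrow> ('d \<Rightarrow> 'v) \<Rightarrow> 'd set \<Rightarrow> bool" where
  "all_bridges \<alpha> p B \<longleftrightarrow> (\<forall>d\<in>B. (p d, p (\<alpha> d)) \<notin> (dart_rel \<alpha> p (B - {d, \<alpha> d}))\<^sup>*)"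

lemma dart_relI: "d \<in> B \<Longrightarrow> (p d, p (\<alpha> d)) \<in> dart_rel \<alpha> p B"
  by (auto simp: dart_rel_def)

lemma dart_rel_mono: "A \<subseteq> B \<Longrightarrow> dart_rel \<alpha> p A \<subseteq> dart_rel \<alpha> p B"
  by (auto simp: dart_rel_def)

lemma dart_connected_mono:
  "dart_connected \<alpha> p A V \<Longrightarrow> A \<subseteq> B \<Longrightarrow> dart_connected \<alpha> p B V"
  unfolding dart_connected_def using rtrancl_mono[OF dart_rel_mono] by blast

text \<open>The vertices reachable from \<open>u\<close> form a closed set, so it suffices to treat
  arbitrary nonempty closed sets. These define cuts, to which the parity arguments apply; no walks
  have to be built.\<close>

lemma dart_connectedI:
  assumes "\<And>U. U \<subseteq> V \<Longrightarrow> U \<noteq> {} \<Longrightarrow> (\<And>d. d \<in> B \<Longrightarrow> p d \<in> U \<Longrightarrow> p (\<alpha> d) \<in> U) \<Longrightarrow> U = V"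
    and "\<And>d. d \<in> B \<Longrightarrow> p (\<alpha> d) \<in> V"
  shows "dart_connected \<alpha> p B V"
  unfolding dart_connected_def
proof (intro ballI)
  fix u v assume uv: "u \<in> V" "v \<in> V"
  define U where "U = {w\<in>V. (u, w) \<in> (dart_rel \<alpha> p B)\<^sup>*}"
  have "U = V"
  proof (rule assms(1))
    show "U \<subseteq> V" "U \<noteq> {}" using uv by (auto simp: U_def)
    show "p (\<alpha> d) \<in> U" if "d \<in> B" "p d \<in> U" for d
      using that assms(2)[of d] by (auto simp: U_def intro: rtrancl_into_rtrancl dart_relI)
  qed
  then show "(u, v) \<in> (dart_rel \<alpha> p B)\<^sup>*" using uv by (auto simp: U_def)
qed

lemma dart_connected_closed:
  assumes "dart_connected \<alpha> p B V" "u \<in> V" "u \<in> U" "v \<in> V"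
    and "\<And>d. d \<in> B \<Longrightarrow> p d \<in> U \<Longrightarrow> p (\<alpha> d) \<in> U"
  shows "v \<in> U"
proof -
  have "(u, v) \<in> (dart_rel \<alpha> p B)\<^sup>*" using assms by (auto simp: dart_connected_def)
  then show ?thesis
    by (induction rule: rtrancl_induct) (use assms in \<open>auto simp: dart_rel_def\<close>)
qed

text \<open>Going round the cycles of \<open>g\<close>, a predicate is switched on as often as it is
  switched off: \<open>g\<close> maps the elements with \<open>P (g d)\<close> bijectively onto
  those with \<open>P d\<close>.\<close>

lemma even_card_changes:
  fixes P :: "'a \<Rightarrow> bool"
  assumes "finite F" "inj_on g F" "g ` F = F"
  shows "even (card {d\<in>F. P d \<noteq> P (g d)})"
proof -
  let ?A = "{d\<in>F. P d}" and ?B = "{d\<in>F. P (g d)}"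
  have "g ` ?B = ?A" using assms(3) by auto
  moreover have "inj_on g ?B" using assms(2) by (rule inj_on_subset) auto
  ultimately have c: "card ?A = card ?B" by (metis card_image)
  have "card ?A = card (?A - ?B) + card (?A \<inter> ?B)" "card ?B = card (?B - ?A) + card (?A \<inter> ?B)"
    using assms(1) by (auto simp: card_Diff_subset_Int Int_commute card_mono)
  then have "card (?A - ?B) = card (?B - ?A)" using c by simp
  moreover have "{d\<in>F. P d \<noteq> P (g d)} = (?A - ?B) \<union> (?B - ?A)" by auto
  moreover have "card ((?A - ?B) \<union> (?B - ?A)) = card (?A - ?B) + card (?B - ?A)"
    using assms(1) by (intro card_Un_disjoint) auto
  ultimately show ?thesis by simp
qed

lemma rtrancl_imp_distinct_path:
  assumes "(x, y) \<in> r\<^sup>*"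
  shows "\<exists>xs. xs \<noteq> [] \<and> hd xs = x \<and> last xs = y \<and> distinct xs \<and>
           successively (\<lambda>u v. (u, v) \<in> r) xs"
  using assms
proof (induction rule: converse_rtrancl_induct)
  case base
  show ?case by (rule exI[of _ "[y]"]) simp
next
  case (step x z)
  then obtain xs where xs: "xs \<noteq> []" "hd xs = z" "last xs = y" "distinct xs"
    "successively (\<lambda>u v. (u, v) \<in> r) xs" by blast
  show ?case
  proof (cases "x \<in> set xs")
    case True
    then obtain ys zs where "xs = ys @ x # zs" by (auto dest: split_list)
    \<comment> \<open>The new start already occurs on the path, so the detour \<open>ys\<close>
      before it is cut off.\<close>
    then show ?thesis using xs
      by (intro exI[of _ "x # zs"]) (auto simp: successively_append_iff split: if_splits)
  next
    case False
    then show ?thesis using xs step(1)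
      by (intro exI[of _ "x # xs"]) (auto simp: successively_Cons)
  qed
qed

section \<open>Spanning trees, bridges and even subgraphs of a dart multigraph\<close>

locale dart_involution =
  fixes D :: "'d set" and \<alpha> :: "'d \<Rightarrow> 'd"
  assumes finite_darts: "finite D"
    and inv_in: "d \<in> D \<Longrightarrow> \<alpha> d \<in> D"
    and inv_inv: "d \<in> D \<Longrightarrow> \<alpha> (\<alpha> d) = d"
    and inv_neq: "d \<in> D \<Longrightarrow> \<alpha> d \<noteq> d"
begin

lemma even_card_inv_closed:
  assumes "B \<subseteq> D" "\<And>d. d \<in> B \<Longrightarrow> \<alpha> d \<in> B"
  shows "even (card B)"
  using assms
proof (induction "card B" arbitrary: B rule: less_induct)
  case less
  have fin: "finite B" using less.prems(1) finite_darts finite_subset by auto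
  show ?case
  proof (cases "B = {}")
    case False
    then obtain d where d: "d \<in> B" by auto
    let ?B = "B - {d, \<alpha> d}"
    have sub: "{d, \<alpha> d} \<subseteq> B" using d less.prems by auto
    have c2: "card {d, \<alpha> d} = 2" using inv_neq d less.prems by (metis card_2_iff subsetD)
    have card: "card B = card ?B + 2"
      using card_Diff_subset[OF _ sub] card_mono[OF fin sub] c2 by simp
    have "even (card ?B)"
    proof (rule less.hyps)
      show "card ?B < card B" using card by simp
      show "?B \<subseteq> D" using less.prems by auto
      show "\<alpha> x \<in> ?B" if "x \<in> ?B" for x
        using that less.prems d inv_inv by (metis Diff_iff insert_iff empty_iff subsetD)
    qed
    then show ?thesis using card by simp
  qed simp
qed

lemma dart_rel_rtrancl_sym:
  assumes "B \<subseteq> D" "\<And>d. d \<in> B \<Longrightarrow> \<alpha> d \<in> B" "(u, v) \<in> (dart_rel \<alpha> p B)\<^sup>*"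
  shows "(v, u) \<in> (dart_rel \<alpha> p B)\<^sup>*"
proof -
  have "sym (dart_rel \<alpha> p B)"
    unfolding sym_def dart_rel_def using assms(1,2) inv_inv by clarsimp (metis subsetD)
  then show ?thesis using assms(3) by (metis sym_rtrancl symD)
qed

lemma dart_connected_remove:
  assumes B: "B \<subseteq> D" "\<And>d. d \<in> B \<Longrightarrow> \<alpha> d \<in> B" and d: "d \<in> B"
    and conn: "dart_connected \<alpha> p B V"
    and alt: "(p d, p (\<alpha> d)) \<in> (dart_rel \<alpha> p (B - {d, \<alpha> d}))\<^sup>*"
  shows "dart_connected \<alpha> p (B - {d, \<alpha> d}) V"
proof -
  let ?B = "B - {d, \<alpha> d}"
  have cl: "\<alpha> x \<in> ?B" if "x \<in> ?B" for x
    using that B d inv_inv by (metis Diff_iff insert_iff empty_iff subsetD)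
  have alt': "(p (\<alpha> d), p (\<alpha> (\<alpha> d))) \<in> (dart_rel \<alpha> p ?B)\<^sup>*"
    using dart_rel_rtrancl_sym[OF _ cl alt] B d inv_inv by (metis Diff_subset subset_trans subsetD)
  have "dart_rel \<alpha> p B \<subseteq> (dart_rel \<alpha> p ?B)\<^sup>*"
  proof
    fix e assume "e \<in> dart_rel \<alpha> p B"
    then obtain x where x: "x \<in> B" "e = (p x, p (\<alpha> x))" by (auto simp: dart_rel_def)
    show "e \<in> (dart_rel \<alpha> p ?B)\<^sup>*"
    proof (cases "x \<in> ?B")
      case True then show ?thesis using x(2) by (auto intro: dart_relI)
    next
      case False then show ?thesis using x alt alt' by auto
    qed
  qed
  then have "(dart_rel \<alpha> p B)\<^sup>* \<subseteq> (dart_rel \<alpha> p ?B)\<^sup>*" by (rule rtrancl_subset_rtrancl)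
  then show ?thesis using conn by (auto simp: dart_connected_def)
qed

text \<open>As long as a vertex is missing, connectedness provides an edge leaving the vertex set
  \<open>W\<close> of the subtree built so far; adding it adds one vertex and two darts. Induction
  on the number of edges, starting from a single vertex.\<close>

lemma spanning_tree_exists:
  assumes B: "B \<subseteq> D" "\<And>d. d \<in> B \<Longrightarrow> \<alpha> d \<in> B"
    and V: "finite V" "V \<noteq> {}" "\<And>d. d \<in> B \<Longrightarrow> p d \<in> V"
    and conn: "dart_connected \<alpha> p B V"
  shows "\<exists>A\<subseteq>B. (\<forall>d\<in>A. \<alpha> d \<in> A) \<and> dart_connected \<alpha> p A V \<and> card A = 2 * (card V - 1)"
proof -
  have "\<exists>W A. W \<subseteq> V \<and> card W = Suc k \<and> A \<subseteq> B \<and> (\<forall>d\<in>A. \<alpha> d \<in> A \<and> p d \<in> W) \<and>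
          dart_connected \<alpha> p A W \<and> card A = 2 * k" if "k < card V" for k
    using that
  proof (induction k)
    case 0
    obtain v where "v \<in> V" using V by auto
    then show ?case
      by (intro exI[of _ "{v}"] exI[of _ "{}"]) (auto simp: dart_connected_def)
  next
    case (Suc k)
    then obtain W A where WA: "W \<subseteq> V" "card W = Suc k" "A \<subseteq> B" "\<And>d. d \<in> A \<Longrightarrow> \<alpha> d \<in> A"
        "\<And>d. d \<in> A \<Longrightarrow> p d \<in> W" "dart_connected \<alpha> p A W" "card A = 2 * k"
      by auto
    have finW: "finite W" using WA(2) by (metis card.infinite nat.distinct(1))
    have finA: "finite A" using WA(3) B(1) finite_darts finite_subset by metis
    have "W \<noteq> V" using WA(2) Suc.prems by auto
    then obtain v where v: "v \<in> V" "v \<notin> W" using WA(1) by auto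
    obtain w where w: "w \<in> W" using WA(2) by (metis card.empty nat.distinct(1) equals0I)
    obtain g where g: "g \<in> B" "p g \<in> W" "p (\<alpha> g) \<notin> W"
      using dart_connected_closed[OF conn _ w v(1)] w v(2) WA(1) by (metis subsetD)
    have gD: "g \<in> D" "\<alpha> g \<in> B" using g(1) B by auto
    have gA: "g \<notin> A" "\<alpha> g \<notin> A" "g \<noteq> \<alpha> g"
      using g WA(4,5) inv_inv[of g] gD by auto
    let ?A = "A \<union> {g, \<alpha> g}" and ?W = "insert (p (\<alpha> g)) W"
    have cA: "\<alpha> d \<in> ?A" if "d \<in> ?A" for d
      using that WA(4) inv_inv gD by auto
    have old: "(x, y) \<in> (dart_rel \<alpha> p ?A)\<^sup>*" if "x \<in> W" "y \<in> W" for x y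
      using that WA(6) dart_connected_mono[of \<alpha> p A W ?A] by (auto simp: dart_connected_def)
    have new: "(p g, p (\<alpha> g)) \<in> (dart_rel \<alpha> p ?A)\<^sup>*"
      using dart_relI[of g ?A p \<alpha>] by auto
    have fwd: "(x, p (\<alpha> g)) \<in> (dart_rel \<alpha> p ?A)\<^sup>*" if "x \<in> W" for x
      using old[OF that g(2)] new by (rule rtrancl_trans)
    have bwd: "(p (\<alpha> g), x) \<in> (dart_rel \<alpha> p ?A)\<^sup>*" if "x \<in> W" for x
      using dart_rel_rtrancl_sym[OF _ cA fwd[OF that]] WA(3) g(1) gD B(1) by auto
    have "dart_connected \<alpha> p ?A ?W"
      unfolding dart_connected_def using old fwd bwd by auto
    moreover have "card ?A = 2 * Suc k"
      using card_Un_disjoint[of A "{g, \<alpha> g}"] finA gA WA(7) by auto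
    moreover have "card ?W = Suc (Suc k)" using finW g(3) WA(2) by auto
    moreover have "p d \<in> ?W" if "d \<in> ?A" for d using that WA(5) g(2) by auto
    ultimately show ?case
      using WA(1,3) g(1) gD V(3) cA by (intro exI[of _ ?W] exI[of _ ?A]) auto
  qed
  from this[of "card V - 1"] obtain W A where "W \<subseteq> V" "card W = Suc (card V - 1)" "A \<subseteq> B"
      "\<forall>d\<in>A. \<alpha> d \<in> A \<and> p d \<in> W" "dart_connected \<alpha> p A W" "card A = 2 * (card V - 1)"
    using V(1,2) by (metis card_gt_0_iff diff_less zero_less_one)
  then have WA: "W \<subseteq> V" "card W = card V" "A \<subseteq> B"
      "\<forall>d\<in>A. \<alpha> d \<in> A" "dart_connected \<alpha> p A W" "card A = 2 * (card V - 1)"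
    using V(1,2) card_gt_0_iff[of V] by simp_all
  have "W = V" using WA(1,2) V(1) card_subset_eq by blast
  then show ?thesis using WA by auto
qed

lemma card_connected_ge:
  assumes "B \<subseteq> D" "\<And>d. d \<in> B \<Longrightarrow> \<alpha> d \<in> B" "finite V" "V \<noteq> {}" "\<And>d. d \<in> B \<Longrightarrow> p d \<in> V"
    and "dart_connected \<alpha> p B V"
  shows "2 * card V \<le> card B + 2"
proof -
  have "finite B" using assms(1) finite_darts finite_subset by auto
  then show ?thesis using spanning_tree_exists[OF assms] card_mono[of B] by fastforce
qed

text \<open>Deleting an edge that is not a bridge would leave a connected graph with fewer darts
  than \<open>card_connected_ge\<close> permits.\<close>

lemma tight_imp_all_bridges:
  assumes B: "B \<subseteq> D" "\<And>d. d \<in> B \<Longrightarrow> \<alpha> d \<in> B"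
    and V: "finite V" "V \<noteq> {}" "\<And>d. d \<in> B \<Longrightarrow> p d \<in> V"
    and conn: "dart_connected \<alpha> p B V" and card: "card B + 2 \<le> 2 * card V"
  shows "all_bridges \<alpha> p B"
  unfolding all_bridges_def
proof (intro ballI notI)
  fix d assume d: "d \<in> B" and alt: "(p d, p (\<alpha> d)) \<in> (dart_rel \<alpha> p (B - {d, \<alpha> d}))\<^sup>*"
  let ?B = "B - {d, \<alpha> d}"
  have fin: "finite B" using B(1) finite_darts finite_subset by auto
  have cl: "\<alpha> x \<in> ?B" if "x \<in> ?B" for x
    using that B d inv_inv by (metis Diff_iff insert_iff empty_iff subsetD)
  have "dart_connected \<alpha> p ?B V" by (rule dart_connected_remove[OF B d conn alt])
  then have "2 * card V \<le> card ?B + 2"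
    using card_connected_ge[OF _ cl V(1,2)] B(1) V(3) by blast
  moreover have "card ?B < card B" using d fin by (intro psubset_card_mono) auto
  ultimately show False using card by simp
qed

text \<open>An even subgraph of a forest has no edge. If it contained \<open>d\<close>, let
  \<open>U\<close> be the side of \<open>p d\<close> once this bridge is deleted. The darts of
  \<open>N\<close> starting in \<open>U\<close> are even in number by the degree condition, but
  apart from \<open>d\<close> they come in pairs, because no other edge leaves
  \<open>U\<close>.\<close>

lemma even_subset_of_bridges_empty:
  assumes B: "B \<subseteq> D" "\<And>d. d \<in> B \<Longrightarrow> \<alpha> d \<in> B" and br: "all_bridges \<alpha> p B"
    and N: "N \<subseteq> B" "\<And>d. d \<in> N \<Longrightarrow> \<alpha> d \<in> N"
    and even: "\<And>v. even (card {d\<in>N. p d = v})"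
  shows "N = {}"
proof (rule ccontr)
  assume "N \<noteq> {}"
  then obtain d where d: "d \<in> N" by auto
  let ?B = "B - {d, \<alpha> d}"
  define U where "U = {u. (p d, u) \<in> (dart_rel \<alpha> p ?B)\<^sup>*}"
  have step: "p (\<alpha> x) \<in> U" if "x \<in> ?B" "p x \<in> U" for x
    using that by (auto simp: U_def intro: rtrancl_into_rtrancl dart_relI)
  have dU: "p d \<in> U" "p (\<alpha> d) \<notin> U" using br d N(1) by (auto simp: U_def all_bridges_def)
  have finN: "finite N" using N(1) B(1) finite_darts finite_subset by metis
  let ?M = "{x\<in>N. p x \<in> U}"
  have "card ?M = (\<Sum>u\<in>p ` ?M. card {x\<in>N. p x = u})"
  proof -
    have "?M = (\<Union>u\<in>p ` ?M. {x\<in>N. p x = u})" by auto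
    moreover have "card (\<Union>u\<in>p ` ?M. {x\<in>N. p x = u}) = (\<Sum>u\<in>p ` ?M. card {x\<in>N. p x = u})"
      using finN by (intro card_UN_disjoint) auto
    ultimately show ?thesis by simp
  qed
  then have ev: "even (card ?M)" using even by (simp add: dvd_sum)
  have "even (card (?M - {d}))"
  proof (rule even_card_inv_closed)
    show "?M - {d} \<subseteq> D" using N(1) B(1) by auto
    fix x assume x: "x \<in> ?M - {d}"
    then have "x \<noteq> \<alpha> d" using dU by auto
    then have "p (\<alpha> x) \<in> U" using x N(1) by (intro step) auto
    moreover have "\<alpha> x \<noteq> d" using \<open>x \<noteq> \<alpha> d\<close> x N(1) B(1) inv_inv by (metis Diff_iff mem_Collect_eq subsetD)
    ultimately show "\<alpha> x \<in> ?M - {d}" using x N(2) by auto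
  qed
  moreover have "d \<in> ?M" using d dU by auto
  moreover have "finite ?M" using finN by simp
  ultimately show False using ev card_Suc_Diff1[of ?M d] by (metis even_Suc)
qed

text \<open>The rest of the cycle connects the ends of its closing edge \<open>d\<close>. It avoids
  both darts of that edge: the vertices are distinct, and the reversed dart could only be met in a
  cycle with two vertices.\<close>

lemma all_bridges_no_cycle:
  assumes B: "B \<subseteq> D" "\<And>d. d \<in> B \<Longrightarrow> \<alpha> d \<in> B" and br: "all_bridges \<alpha> p B"
    and len: "length xs \<ge> 3" and dist: "distinct xs"
    and step: "\<And>i. i < length xs \<Longrightarrow>
      \<exists>d\<in>B. p d = xs ! i \<and> p (\<alpha> d) = xs ! ((i + 1) mod length xs)"
  shows False
proof -
  let ?n = "length xs"
  obtain d where d: "d \<in> B" "p d = xs ! (?n - 1)" "p (\<alpha> d) = xs ! 0"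
    using step[of "?n - 1"] len by (cases xs) auto
  let ?B = "B - {d, \<alpha> d}"
  have cl: "\<alpha> x \<in> ?B" if "x \<in> ?B" for x
    using that B d inv_inv by (metis Diff_iff insert_iff empty_iff subsetD)
  have "(xs ! 0, xs ! i) \<in> (dart_rel \<alpha> p ?B)\<^sup>*" if "i < ?n" for i
    using that
  proof (induction i)
    case (Suc i)
    obtain x where x: "x \<in> B" "p x = xs ! i" "p (\<alpha> x) = xs ! Suc i"
      using step[of i] Suc.prems by auto
    have "x \<noteq> d" using x(2) d(2) dist Suc.prems by (auto simp: nth_eq_iff_index_eq)
    moreover have "x \<noteq> \<alpha> d"
    proof
      assume "x = \<alpha> d"
      then have "xs ! i = xs ! 0" "xs ! Suc i = xs ! (?n - 1)"
        using x d inv_inv B by (metis, metis subsetD)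
      then have "i = 0" "Suc i = ?n - 1"
        using nth_eq_iff_index_eq[OF dist, of i 0] nth_eq_iff_index_eq[OF dist, of "Suc i" "?n - 1"]
          Suc.prems by fastforce+
      then show False using len by simp
    qed
    ultimately have "(xs ! i, xs ! Suc i) \<in> dart_rel \<alpha> p ?B"
      using x dart_relI[of x ?B p \<alpha>] by auto
    then show ?case using Suc by (auto intro: rtrancl_into_rtrancl)
  qed simp
  then have "(p (\<alpha> d), p d) \<in> (dart_rel \<alpha> p ?B)\<^sup>*" 
    using d len by (metis diff_less less_le_trans zero_less_numeral zero_less_one)
  moreover have "?B \<subseteq> D" using B(1) by auto
  ultimately have "(p d, p (\<alpha> d)) \<in> (dart_rel \<alpha> p ?B)\<^sup>*"
    using dart_rel_rtrancl_sym[OF _ cl, where p = p] by metis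
  then show False using br d(1) by (auto simp: all_bridges_def)
qed

end

section \<open>Face-coloured Barnette graphs\<close>

locale coloured_barnette =
  fixes D :: "'d set" and \<alpha> \<sigma> :: "'d \<Rightarrow> 'd" and col :: "'d set \<Rightarrow> nat"
  assumes barnette: "barnette D \<alpha> \<sigma>"
    and coloring: "proper_face_3_coloring D \<alpha> \<sigma> col"
begin

abbreviation vert :: "'d \<Rightarrow> 'd set" where "vert \<equiv> vertex_of \<sigma>"
abbreviation face :: "'d \<Rightarrow> 'd set" where "face \<equiv> face_of \<alpha> \<sigma>"
abbreviation verts :: "'d set set" where "verts \<equiv> map_verts D \<sigma>"
abbreviation faces :: "'d set set" where "faces \<equiv> map_faces D \<alpha> \<sigma>"
abbreviation dcol :: "'d \<Rightarrow> nat" where "dcol d \<equiv> col (face d)"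

section \<open>Rotations, faces and colours at a cubic vertex\<close>

lemma map_facts:
  shows "finite D" "D \<noteq> {}" "\<alpha> permutes D" "\<sigma> permutes D" "map_connected D \<alpha> \<sigma>"
    "d \<in> D \<Longrightarrow> \<alpha> (\<alpha> d) = d" "d \<in> D \<Longrightarrow> \<alpha> d \<noteq> d"
  using barnette by (auto simp: barnette_def plane_map_def comb_map_def)

sublocale dart_involution D \<alpha>
  using map_facts by unfold_locales (auto simp: permutes_in_image)

lemma rot_in: "d \<in> D \<Longrightarrow> \<sigma> d \<in> D"
  using map_facts(4) by (simp add: permutes_in_image)

lemma rot_eq_iff: "\<sigma> x = \<sigma> y \<longleftrightarrow> x = y"
  using permutes_inj[OF map_facts(4)] by (auto dest: injD)

lemma inv_eq_iff: "\<alpha> x = \<alpha> y \<longleftrightarrow> x = y"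
  using permutes_inj[OF map_facts(3)] by (auto dest: injD)

lemma face_perm_permutes: "(\<sigma> \<circ> \<alpha>) permutes D"
  using map_facts(3,4) by (rule permutes_compose)

lemma permutations: "permutation \<sigma>" "permutation (\<sigma> \<circ> \<alpha>)"
  using map_facts(1,4) face_perm_permutes by (auto simp: permutation_permutes)

lemma vert_self: "d \<in> vert d" and face_self: "d \<in> face d"
  unfolding vertex_of_def face_of_def using permutations by (auto intro: permutation_self_in_orbit)

lemma vert_rot: "vert (\<sigma> d) = vert d"
  unfolding vertex_of_def using permutations(1) by (rule permutation_orbit_step)

lemma face_step: "face (\<sigma> (\<alpha> d)) = face d"
  unfolding face_of_def using permutation_orbit_step[OF permutations(2), of d] by simp

text \<open>As faces are orbits of \<open>\<sigma> \<circ> \<alpha>\<close>, the face across the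
  edge of \<open>d\<close> is the face of the next dart at the same vertex. Hence the three darts at
  a vertex represent its three faces, and adjacency of faces can be read off there.\<close>

lemma face_inv: "d \<in> D \<Longrightarrow> face (\<alpha> d) = face (\<sigma> d)"
  using face_step[of "\<alpha> d"] by (simp add: inv_inv)

lemma vert_eq: "y \<in> vert x \<Longrightarrow> vert y = vert x" and face_eq: "y \<in> face x \<Longrightarrow> face y = face x"
  unfolding vertex_of_def face_of_def using permutations
  by (metis orbit_cyclic_eq3 cyclic_on_orbit')+

lemma vert_subset: "d \<in> D \<Longrightarrow> vert d \<subseteq> D" and face_subset: "d \<in> D \<Longrightarrow> face d \<subseteq> D"
  unfolding vertex_of_def face_of_def
  using map_facts(4) face_perm_permutes by (auto intro: permutes_orbit_subset[THEN subsetD])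

lemma face_closed: "x \<in> face d \<Longrightarrow> \<sigma> (\<alpha> x) \<in> face d"
  using face_self face_step face_eq by metis

lemma rot_cycle:
  assumes "d \<in> D"
  shows "\<sigma> d \<noteq> d" "\<sigma> (\<sigma> d) \<noteq> d" "\<sigma> (\<sigma> d) \<noteq> \<sigma> d" "\<sigma> (\<sigma> (\<sigma> d)) = d"
    "vert d = {d, \<sigma> d, \<sigma> (\<sigma> d)}"
proof -
  have c: "card (vert d) = 3" using barnette assms by (auto simp: barnette_def map_cubic_def)
  have mem: "d \<in> vert d" "\<sigma> d \<in> vert d" "\<sigma> (\<sigma> d) \<in> vert d" "\<sigma> (\<sigma> (\<sigma> d)) \<in> vert d"
    using vert_self vert_rot by metis+
  show 1: "\<sigma> d \<noteq> d"
  proof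
    assume "\<sigma> d = d"
    then have "vert d = {d}" by (simp add: vertex_of_def orbit_eq_singleton_iff)
    then show False using c by simp
  qed
  then show 2: "\<sigma> (\<sigma> d) \<noteq> \<sigma> d" by (simp add: rot_eq_iff)
  show 3: "\<sigma> (\<sigma> d) \<noteq> d"
  proof
    assume e: "\<sigma> (\<sigma> d) = d"
    have "x \<in> {d, \<sigma> d}" if "x \<in> orbit \<sigma> d" for x
      using that by induction (auto simp: e)
    then have "vert d \<subseteq> {d, \<sigma> d}" by (auto simp: vertex_of_def)
    then have "card (vert d) \<le> card {d, \<sigma> d}" by (intro card_mono) auto
    then show False using c card_insert_le_m1[of 2 "{\<sigma> d}" d] by simp
  qed
  have "finite (vert d)" using c by (metis card.infinite zero_neq_numeral)
  moreover have "card {d, \<sigma> d, \<sigma> (\<sigma> d)} = 3" using 1 2 3 by auto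
  ultimately show 4: "vert d = {d, \<sigma> d, \<sigma> (\<sigma> d)}"
    using c mem card_subset_eq[of "vert d" "{d, \<sigma> d, \<sigma> (\<sigma> d)}"] by auto
  then show "\<sigma> (\<sigma> (\<sigma> d)) = d" using mem(4) 1 2 3 by (auto simp: rot_eq_iff)
qed

lemma vert_memE:
  assumes "y \<in> vert x" "x \<in> D"
  obtains "y = x" | "y = \<sigma> x" | "y = \<sigma> (\<sigma> x)"
  using assms rot_cycle(5) by auto

lemma vert_in: "d \<in> D \<Longrightarrow> vert d \<in> verts" and face_in: "d \<in> D \<Longrightarrow> face d \<in> faces"
  by (auto simp: map_verts_def map_faces_def)

lemma vertsE: assumes "v \<in> verts" obtains d where "d \<in> D" "v = vert d"
  using assms by (auto simp: map_verts_def)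

lemma facesE: assumes "F \<in> faces" obtains d where "d \<in> D" "F = face d"
  using assms by (auto simp: map_faces_def)

lemma dcol_cases: "d \<in> D \<Longrightarrow> dcol d = 1 \<or> dcol d = 2 \<or> dcol d = 3"
  using coloring face_in by (auto simp: proper_face_3_coloring_def)

lemma dcol_inv_neq: "d \<in> D \<Longrightarrow> dcol (\<alpha> d) \<noteq> dcol d"
  using coloring by (auto simp: proper_face_3_coloring_def)

lemma dcol_inv: "d \<in> D \<Longrightarrow> dcol (\<alpha> d) = dcol (\<sigma> d)"
  by (simp add: face_inv)

lemma dcol_rot_neq:
  assumes "d \<in> D"
  shows "dcol (\<sigma> d) \<noteq> dcol d" "dcol (\<sigma> (\<sigma> d)) \<noteq> dcol d" "dcol (\<sigma> (\<sigma> d)) \<noteq> dcol (\<sigma> d)"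
  using dcol_inv_neq[of d] dcol_inv_neq[of "\<sigma> d"] dcol_inv_neq[of "\<sigma> (\<sigma> d)"] assms
    rot_cycle(4)[of d] by (auto simp: face_inv rot_in)

lemma no_loop: "d \<in> D \<Longrightarrow> vert (\<alpha> d) \<noteq> vert d"
  using barnette by (auto simp: barnette_def map_simple_def)

lemma no_parallel:
  "d \<in> D \<Longrightarrow> d' \<in> D \<Longrightarrow> vert d = vert d' \<Longrightarrow> vert (\<alpha> d) = vert (\<alpha> d') \<Longrightarrow> d = d'"
  using barnette by (auto simp: barnette_def map_simple_def)

text \<open>Otherwise \<open>d\<close> and the reverse of the next dart on its face would have the
  same start and the same end; simplicity identifies them, and then \<open>\<sigma> d = d\<close>.
  This rules out digons and so provides a second edge of the same kind on a face.\<close>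

lemma face_step2_neq:
  assumes "d \<in> D" shows "\<sigma> (\<alpha> (\<sigma> (\<alpha> d))) \<noteq> d"
proof
  let ?e = "\<sigma> (\<alpha> d)"
  assume eq: "\<sigma> (\<alpha> ?e) = d"
  have D: "?e \<in> D" "\<alpha> ?e \<in> D" using assms by (auto simp: rot_in inv_in)
  have "vert (\<alpha> ?e) = vert d" using vert_rot[of "\<alpha> ?e"] eq by simp
  moreover have "vert (\<alpha> (\<alpha> ?e)) = vert (\<alpha> d)" using D by (simp add: inv_inv vert_rot)
  ultimately have "\<alpha> ?e = d" using no_parallel[of "\<alpha> ?e" d] assms D by simp
  then have "\<sigma> d = d" using eq by simp
  then show False using rot_cycle(1) assms by blast
qed

lemma finite_verts: "finite verts" "verts \<noteq> {}" and finite_faces: "finite faces" "faces \<noteq> {}"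
  using map_facts(1,2) by (auto simp: map_verts_def map_faces_def)

lemma verts_disjoint: "v \<in> verts \<Longrightarrow> w \<in> verts \<Longrightarrow> v \<noteq> w \<Longrightarrow> v \<inter> w = {}"
  using vert_eq by (metis disjoint_iff vertsE)

lemma vertD: "v \<in> verts \<Longrightarrow> x \<in> v \<Longrightarrow> v = vert x" and faceD: "F \<in> faces \<Longrightarrow> x \<in> F \<Longrightarrow> F = face x"
  using vert_eq face_eq by (metis vertsE, metis facesE)

section \<open>Euler's formula in terms of darts\<close>

lemma card_verts: "card D = 3 * card verts"
proof -
  have "3 * card verts = card (\<Union>verts)"
  proof (rule card_partition)
    show "finite (\<Union>verts)" using vert_subset map_facts(1)
      by (metis (no_types, lifting) Sup_le_iff finite_subset vertsE)
    show "card v = 3" if "v \<in> verts" for v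
    proof -
      obtain d where "d \<in> D" "v = vert d" using \<open>v \<in> verts\<close> by (rule vertsE)
      then show ?thesis using rot_cycle(1,2,3)[of d] rot_cycle(5)[of d] by auto
    qed
  qed (use finite_verts verts_disjoint in auto)
  moreover have "\<Union>verts = D"
    using vert_subset vert_self by (auto simp: map_verts_def)
  ultimately show ?thesis by simp
qed

lemma euler: "2 * card verts + 2 * card faces = card D + 4"
proof -
  have "2 * card (map_edges D \<alpha>) = card (\<Union>(map_edges D \<alpha>))"
  proof (rule card_partition)
    show "card e = 2" if "e \<in> map_edges D \<alpha>" for e
      using that inv_neq by (fastforce simp: map_edges_def edge_of_def)
    show "e \<inter> e' = {}" if "e \<in> map_edges D \<alpha>" "e' \<in> map_edges D \<alpha>" "e \<noteq> e'" for e e'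
      using that by (auto simp: map_edges_def edge_of_def inv_inv inv_eq_iff)
  qed (use map_facts(1) in \<open>auto simp: map_edges_def edge_of_def\<close>)
  moreover have "\<Union>(map_edges D \<alpha>) = D" using inv_in by (auto simp: map_edges_def edge_of_def)
  ultimately show ?thesis using barnette by (auto simp: barnette_def plane_map_def)
qed

lemma euler_verts: "2 * card faces = card verts + 4"
  using euler card_verts by simp

section \<open>Parity around faces and vertices, and the dual of a forest\<close>

lemma even_card_face_changes:
  fixes P :: "'d \<Rightarrow> bool" assumes "d \<in> D" shows "even (card {x\<in>face d. P x \<noteq> P (\<sigma> (\<alpha> x))})"
proof (rule even_card_changes)
  show fin: "finite (face d)" using face_subset[OF assms] map_facts(1) finite_subset by auto
  show inj: "inj_on (\<lambda>x. \<sigma> (\<alpha> x)) (face d)" by (auto simp: inj_on_def rot_eq_iff inv_eq_iff)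
  show "(\<lambda>x. \<sigma> (\<alpha> x)) ` face d = face d"
    using endo_inj_surj[OF fin _ inj] face_closed by auto
qed

lemma even_card_vert_changes:
  fixes P :: "'d \<Rightarrow> bool" assumes "d \<in> D" shows "even (card {x\<in>vert d. P x \<noteq> P (\<sigma> x)})"
proof (rule even_card_changes)
  show fin: "finite (vert d)" using rot_cycle(5)[OF assms] by simp
  show "inj_on \<sigma> (vert d)" by (auto simp: inj_on_def rot_eq_iff)
  show "\<sigma> ` vert d = vert d" using rot_cycle(4,5)[OF assms] by auto
qed

text \<open>For a set of faces closed under the edges outside the forest, the edges between the set
  and its complement all lie in the forest, and every vertex meets an even number of them. An even
  subgraph of a forest is empty, so the set is closed under all edges, and connectedness of the map
  makes it contain every face.\<close>

lemma cotree_connected: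
  assumes B: "B \<subseteq> D" "\<And>d. d \<in> B \<Longrightarrow> \<alpha> d \<in> B" "all_bridges \<alpha> vert B"
  shows "dart_connected \<alpha> face (D - B) faces"
proof (rule dart_connectedI)
  show "face (\<alpha> d) \<in> faces" if "d \<in> D - B" for d using that by (auto intro: face_in inv_in)
  fix U assume U: "U \<subseteq> faces" "U \<noteq> {}"
    and cl: "\<And>d. d \<in> D - B \<Longrightarrow> face d \<in> U \<Longrightarrow> face (\<alpha> d) \<in> U"
  let ?N = "{d\<in>D. (face d \<in> U) \<noteq> (face (\<alpha> d) \<in> U)}"
  have "?N = {}"
  proof (rule even_subset_of_bridges_empty[OF B])
    show "?N \<subseteq> B"
    proof
      fix d assume d: "d \<in> ?N"
      show "d \<in> B"
      proof (rule ccontr)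
        assume "d \<notin> B"
        then have "d \<in> D - B" "\<alpha> d \<in> D - B" using d B(2)[of "\<alpha> d"] by (auto simp: inv_in inv_inv)
        then show False using cl[of d] cl[of "\<alpha> d"] d by (auto simp: inv_inv)
      qed
    qed
    show "\<alpha> d \<in> ?N" if "d \<in> ?N" for d using that by (auto simp: inv_in inv_inv)
    show "even (card {d\<in>?N. vert d = v})" for v
    proof (cases "\<exists>e\<in>D. v = vert e")
      case True
      then obtain e where e: "e \<in> D" "v = vert e" by auto
      \<comment> \<open>By \<open>face_inv\<close>, the cut edges at a vertex are the places where
        the rotation around it passes into or out of \<open>U\<close>.\<close>
      have "{d\<in>?N. vert d = v} = {x\<in>vert e. (face x \<in> U) \<noteq> (face (\<sigma> x) \<in> U)}"
        using e vert_subset[OF e(1)] by (auto simp: face_inv vert_self dest: vert_eq)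
      then show ?thesis using even_card_vert_changes[OF e(1)] by simp
    next
      case False
      then have "{d\<in>?N. vert d = v} = {}" by auto
      then show ?thesis by (metis card.empty even_zero)
    qed
  qed
  then have step: "face d \<in> U \<longleftrightarrow> face (\<alpha> d) \<in> U" if "d \<in> D" for d using that by auto
  obtain x where x: "x \<in> D" "face x \<in> U" using U by (metis all_not_in_conv facesE subsetD)
  have "face y \<in> U" if "y \<in> D" for y
  proof -
    have "(x, y) \<in> {(x, y). x \<in> D \<and> (y = \<alpha> x \<or> y = \<sigma> x)}\<^sup>*"
      using map_facts(5) x(1) that by (auto simp: map_connected_def)
    then show ?thesis
      by (induction rule: rtrancl_induct) (use x step in \<open>auto simp: face_inv\<close>)
  qed
  then show "U = faces" using U(1) by (auto simp: map_faces_def)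
qed

text \<open>Equally coloured edges are disjoint, so deleting one end of each of the two edges leaves a
  connected graph to which both deleted vertices are still attached.\<close>
lemma connected_without_two_edges:
  assumes d: "d \<in> D" "d' \<in> D" "d \<noteq> d'" "d' \<noteq> \<alpha> d"
    and col: "dcol d' = dcol d" "dcol (\<alpha> d') = dcol (\<alpha> d)"
  shows "dart_connected \<alpha> vert (D - {d, \<alpha> d, d', \<alpha> d'}) verts"
proof -
  let ?B = "D - {d, \<alpha> d, d', \<alpha> d'}"
  have cl: "\<alpha> x \<in> ?B" if "x \<in> ?B" for x
    using that d by (auto simp: inv_in inv_inv inv_eq_iff)
  \<comment> \<open>The three edges at a vertex separate three different pairs of colours, so two
    edges with the same pair never meet.\<close>
  have ndis: "y \<noteq> \<sigma> x \<and> y \<noteq> \<sigma> (\<sigma> x)"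
    if "x \<in> D" "y \<in> D" "dcol y = dcol x \<and> dcol (\<alpha> y) = dcol (\<alpha> x) \<or> dcol y = dcol (\<alpha> x) \<and> dcol (\<alpha> y) = dcol x" for x y
    using that dcol_rot_neq[OF that(1)] dcol_rot_neq[OF rot_in[OF that(1)]] rot_cycle(4)[OF that(1)]
    by (auto simp: dcol_inv rot_in)
  have vdis: "vert y \<noteq> vert x"
    if "x \<in> D" "y \<in> D" "y \<noteq> x" "dcol y = dcol x \<and> dcol (\<alpha> y) = dcol (\<alpha> x) \<or> dcol y = dcol (\<alpha> x) \<and> dcol (\<alpha> y) = dcol x" for x y
    using ndis[OF that(1,2,4)] that(3) vert_self[of y] rot_cycle(5)[OF that(1)] by auto
  have "\<alpha> d' \<noteq> d" using d by (metis inv_inv)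
  then have V: "vert d' \<noteq> vert d" "vert (\<alpha> d') \<noteq> vert d" "vert (\<alpha> d) \<noteq> vert d'"
    using vdis[of d d'] vdis[of d "\<alpha> d'"] vdis[of d' "\<alpha> d"] d col by (auto simp: inv_in inv_inv)
  \<comment> \<open>One end of each edge: removing these two vertices destroys both edges and stays
    within what 3-connectedness allows.\<close>
  let ?S = "{vert d, vert d'}"
  have conn: "sg_connected (verts - ?S) (map_vadj \<alpha> \<sigma>)"
  proof -
    have "card ?S \<le> 2" by (simp add: card_insert_if)
    moreover have "?S \<subseteq> verts" using d vert_in by auto
    ultimately show ?thesis using barnette by (auto simp: barnette_def map_3_connected_def)
  qed
  have inner: "(u, w) \<in> (dart_rel \<alpha> vert ?B)\<^sup>*" if "u \<in> verts - ?S" "w \<in> verts - ?S" for u w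
  proof -
    let ?R = "{(a, b). a \<in> verts - ?S \<and> b \<in> verts - ?S \<and> map_vadj \<alpha> \<sigma> a b}"
    have "?R \<subseteq> dart_rel \<alpha> vert ?B"
    proof (rule subrelI)
      fix a b assume "(a, b) \<in> ?R"
      then have ab: "a \<in> verts" "a \<notin> ?S" "b \<in> verts" "b \<notin> ?S" "map_vadj \<alpha> \<sigma> a b" by auto
      then obtain x where x: "x \<in> a" "vert (\<alpha> x) = b" by (auto simp: map_vadj_def)
      have xD: "x \<in> D" "vert x = a" using ab(1) x(1) vert_subset by (auto elim!: vertsE dest: vert_eq)
      have "x \<notin> {d, \<alpha> d, d', \<alpha> d'}" using ab(2,4) x(2) xD d(1,2) by (auto simp: inv_inv)
      then show "(a, b) \<in> dart_rel \<alpha> vert ?B" using dart_relI[of x ?B vert \<alpha>] x(2) xD by auto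
    qed
    then show ?thesis using conn that rtrancl_mono[of ?R] unfolding sg_connected_def by blast
  qed
  \<comment> \<open>A removed vertex keeps its other two edges. By simplicity they lead to two
    different vertices, neither of them the vertex itself, so at most one leads to the other removed
    vertex.\<close>
  have attach: "\<exists>y\<in>?B. vert y = vert x \<and> vert (\<alpha> y) \<in> verts - ?S"
    if x: "x = d \<or> x = d'" for x
  proof -
    have xD: "x \<in> D" using x d by auto
    have B: "\<sigma> x \<in> ?B" "\<sigma> (\<sigma> x) \<in> ?B"
      using ndis[of x d] ndis[of x d'] ndis[of x "\<alpha> d"] ndis[of x "\<alpha> d'"] x d(1,2) col
        rot_cycle[OF xD] no_loop[OF xD] vert_rot
      by (auto simp: rot_in inv_in inv_inv)
    have nx: "vert (\<alpha> (\<sigma> x)) \<noteq> vert x" "vert (\<alpha> (\<sigma> (\<sigma> x))) \<noteq> vert x"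
      using no_loop[of "\<sigma> x"] no_loop[of "\<sigma> (\<sigma> x)"] xD by (auto simp: rot_in vert_rot)
    have "vert (\<alpha> (\<sigma> x)) \<noteq> vert (\<alpha> (\<sigma> (\<sigma> x)))"
      using no_parallel[of "\<sigma> x" "\<sigma> (\<sigma> x)"] rot_cycle(3)[OF xD] xD by (auto simp: rot_in vert_rot)
    then have "vert (\<alpha> (\<sigma> x)) \<notin> ?S \<or> vert (\<alpha> (\<sigma> (\<sigma> x))) \<notin> ?S" using nx x by auto
    then show ?thesis using B by (metis Diff_iff inv_in rot_in vert_in vert_rot xD)
  qed
  have clB: "?B \<subseteq> D" by auto
  have toin: "\<exists>w\<in>verts - ?S. (u, w) \<in> (dart_rel \<alpha> vert ?B)\<^sup>*" if "u \<in> verts" for u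
  proof (cases "u \<in> ?S")
    case True
    then obtain y where "y \<in> ?B" "vert y = u" "vert (\<alpha> y) \<in> verts - ?S" using attach by blast
    then show ?thesis using dart_relI[of y ?B vert \<alpha>] by (metis r_into_rtrancl)
  qed (use that in auto)
  show ?thesis unfolding dart_connected_def
  proof (intro ballI)
    fix u v assume "u \<in> verts" "v \<in> verts"
    then obtain u' v' where "u' \<in> verts - ?S" "(u, u') \<in> (dart_rel \<alpha> vert ?B)\<^sup>*"
        "v' \<in> verts - ?S" "(v, v') \<in> (dart_rel \<alpha> vert ?B)\<^sup>*" using toin by meson
    then show "(u, v) \<in> (dart_rel \<alpha> vert ?B)\<^sup>*"
      using inner[of u' v'] dart_rel_rtrancl_sym[OF clB cl, where p = vert] by (meson rtrancl_trans)
  qed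
qed

text \<open>Two edges with the same two faces would give a spanning tree avoiding both of them; the dual
  graph of its complement is connected with too few edges to contain a double edge.\<close>
lemma common_edge_unique:
  assumes d: "d \<in> D" "d' \<in> D" and f: "face d' = face d" "face (\<alpha> d') = face (\<alpha> d)"
  shows "d' = d"
proof (rule ccontr)
  assume neq: "d' \<noteq> d"
  have na: "d' \<noteq> \<alpha> d" using f(1) dcol_inv_neq[OF d(1)] by auto
  let ?G = "D - {d, \<alpha> d, d', \<alpha> d'}"
  have clG: "\<alpha> x \<in> ?G" if "x \<in> ?G" for x
    using that d by (auto simp: inv_in inv_inv inv_eq_iff)
  have "dart_connected \<alpha> vert ?G verts"
    using connected_without_two_edges[OF d] neq na f by auto
  then obtain B where B: "B \<subseteq> ?G" "\<forall>x\<in>B. \<alpha> x \<in> B" "dart_connected \<alpha> vert B verts"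
      "card B = 2 * (card verts - 1)"
    using spanning_tree_exists[OF _ clG finite_verts, where p = vert] vert_in by auto
  have BD: "B \<subseteq> D" using B(1) by auto
  have clB: "\<alpha> x \<in> B" if "x \<in> B" for x using that B(2) by auto
  have cV: "card verts \<ge> 1" using finite_verts by (simp add: Suc_leI card_gt_0_iff)
  have "all_bridges \<alpha> vert B"
    using B(4) BD vert_in cV by (intro tight_imp_all_bridges[OF BD clB finite_verts _ B(3)]) auto
  then have conn: "dart_connected \<alpha> face (D - B) faces" using cotree_connected[OF BD clB] by blast
  let ?C = "D - B"
  have clC: "\<alpha> x \<in> ?C" if "x \<in> ?C" for x using that clB[of "\<alpha> x"] by (auto simp: inv_in inv_inv)
  have dC: "d \<in> ?C" "d' \<in> ?C" using B(1) d by auto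
  \<comment> \<open>The tree uses \<open>2 * card verts - 2\<close> darts, and by Euler's formula
    exactly \<open>2 * card faces - 2\<close> remain, the size of a spanning tree of the
    dual.\<close>
  have "card ?C + card B = card D"
    using BD map_facts(1) by (simp add: card_Diff_subset finite_subset card_mono)
  then have "card ?C + 2 \<le> 2 * card faces" using B(4) euler cV by simp
  then have "all_bridges \<alpha> face ?C"
    using tight_imp_all_bridges[OF Diff_subset clC finite_faces _ conn] face_in by blast
  moreover have "(face d, face (\<alpha> d)) \<in> dart_rel \<alpha> face (?C - {d, \<alpha> d})"
    using dart_relI[of d' "?C - {d, \<alpha> d}" face \<alpha>] dC neq na f by auto
  ultimately show False using dC(1) by (auto simp: all_bridges_def)
qed

section \<open>Regions of faces\<close>

text \<open>A region is a union of faces containing the faces of colour \<open>a\<close> but none of colour \<open>b\<close>; it is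
  represented by the set of darts of its faces.\<close>

definition region :: "nat \<Rightarrow> nat \<Rightarrow> 'd set \<Rightarrow> bool" where
  "region a b S \<longleftrightarrow> {a, b} = {2, 3} \<and> S \<subseteq> D \<and> (\<forall>d\<in>S. \<sigma> (\<alpha> d) \<in> S) \<and>
     (\<forall>d\<in>D. dcol d = a \<longrightarrow> d \<in> S) \<and> (\<forall>d\<in>S. dcol d \<noteq> b)"

definition boundary :: "'d set \<Rightarrow> 'd set" where
  "boundary S = {d\<in>D. (d \<in> S) \<noteq> (\<alpha> d \<in> S)}"

definition interior_darts :: "'d set \<Rightarrow> 'd set" where
  "interior_darts S = {d\<in>S. \<alpha> d \<in> S}"

text \<open>Two boundary edges meet at every vertex (\<open>card_boundary_vert\<close>), so
  connectedness alone makes the boundary a hamiltonian cycle.\<close>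

definition ham_region :: "nat \<Rightarrow> nat \<Rightarrow> 'd set \<Rightarrow> bool" where
  "ham_region a b S \<longleftrightarrow> region a b S \<and> dart_connected \<alpha> vert (boundary S) verts"

lemma boundary_inv: "d \<in> boundary S \<Longrightarrow> \<alpha> d \<in> boundary S"
  by (auto simp: boundary_def inv_in inv_inv)

lemma boundary_subset: "boundary S \<subseteq> D"
  by (auto simp: boundary_def)

lemma region_subset: "region a b S \<Longrightarrow> S \<subseteq> D"
  by (auto simp: region_def)

lemma region_cols: "region a b S \<Longrightarrow> a = 2 \<and> b = 3 \<or> a = 3 \<and> b = 2"
  by (auto simp: region_def doubleton_eq_iff)

lemma region_face:
  assumes "region a b S" "x \<in> face d" shows "x \<in> S \<longleftrightarrow> d \<in> S"
proof -
  have *: "y \<in> S" if "z \<in> S" "y \<in> orbit (\<sigma> \<circ> \<alpha>) z" for y z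
    using that(2) by induction (use assms(1) that(1) in \<open>auto simp: region_def\<close>)
  have "d \<in> face x" using assms(2) face_eq face_self by metis
  then show ?thesis using assms(2) *[of x d] *[of d x] by (auto simp: face_of_def)
qed

lemma region_face_eq: "region a b S \<Longrightarrow> face x = face d \<Longrightarrow> x \<in> S \<longleftrightarrow> d \<in> S"
  using region_face face_self by metis

lemma region_inv: "region a b S \<Longrightarrow> d \<in> D \<Longrightarrow> \<alpha> d \<in> S \<longleftrightarrow> \<sigma> d \<in> S"
  using region_face_eq face_inv by blast

lemma boundary_iff: "region a b S \<Longrightarrow> d \<in> boundary S \<longleftrightarrow> d \<in> D \<and> (d \<in> S) \<noteq> (\<sigma> d \<in> S)"
  using region_inv by (auto simp: boundary_def)

lemma region_complement:
  assumes "region a b S" shows "region b a (D - S)"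
proof -
  have "\<sigma> (\<alpha> d) \<in> D - S" if "d \<in> D - S" for d
    using that region_face_eq[OF assms face_step[of d]] by (auto simp: rot_in inv_in)
  then show ?thesis using assms by (auto simp: region_def)
qed

lemma boundary_complement: "boundary (D - S) = boundary S"
  by (auto simp: boundary_def inv_in)

lemma ham_region_complement: "ham_region a b S \<Longrightarrow> ham_region b a (D - S)"
  by (simp add: ham_region_def region_complement boundary_complement)

section \<open>The boundary of a region is 2-regular\<close>

lemma vert_colour:
  assumes "d \<in> D" "i \<in> {1, 2, 3}"
  obtains x where "x \<in> D" "vert x = vert d" "dcol x = i"
proof -
  have "dcol d = i \<or> dcol (\<sigma> d) = i \<or> dcol (\<sigma> (\<sigma> d)) = i"
    using dcol_rot_neq[OF assms(1)] dcol_cases[of d] dcol_cases[of "\<sigma> d"]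
      dcol_cases[of "\<sigma> (\<sigma> d)"] assms by (auto simp: rot_in)
  then show ?thesis using that[of d] that[of "\<sigma> d"] that[of "\<sigma> (\<sigma> d)"] assms(1)
    by (auto simp: rot_in vert_rot)
qed

lemma region_vert:
  assumes "region a b S" "d \<in> D"
  obtains x y where "x \<in> vert d" "x \<in> S" "y \<in> vert d" "y \<notin> S"
proof -
  have "a \<in> {1, 2, 3}" "b \<in> {1, 2, 3}" using region_cols[OF assms(1)] by auto
  then obtain x y where "x \<in> D" "vert x = vert d" "dcol x = a" "y \<in> D" "vert y = vert d" "dcol y = b"
    using vert_colour assms(2) by metis
  then show ?thesis using that[of x y] assms(1) vert_self[of x] vert_self[of y] by (auto simp: region_def)
qed

text \<open>Each vertex lies on an \<open>a\<close>-face, which is in the region, and on a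
  \<open>b\<close>-face, which is not. Round a cyclic sequence of three faces, membership that is
  not constant changes exactly twice.\<close>

lemma card_boundary_vert:
  assumes "region a b S" "d \<in> D" shows "card {x\<in>vert d. x \<in> boundary S} = 2"
proof -
  obtain x y where "x \<in> vert d" "x \<in> S" "y \<in> vert d" "y \<notin> S" using region_vert assms by metis
  then have ne: "\<not> ((d \<in> S) = (\<sigma> d \<in> S) \<and> (\<sigma> d \<in> S) = (\<sigma> (\<sigma> d) \<in> S))"
    using rot_cycle(5)[OF assms(2)] by auto
  have "card {x\<in>vert d. x \<in> boundary S} = (\<Sum>x\<in>vert d. if x \<in> boundary S then 1 else 0)"
    using rot_cycle(5)[OF assms(2)] by (simp add: sum.If_cases Int_def)
  also have "\<dots> = 2"
    using rot_cycle[OF assms(2)] ne assms(2) boundary_iff[OF assms(1)] by (auto simp: rot_in)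
  finally show ?thesis .
qed

lemma card_boundary:
  assumes "region a b S" shows "card (boundary S) = 2 * card verts"
proof -
  have "boundary S = (\<Union>v\<in>verts. {x\<in>v. x \<in> boundary S})"
    using boundary_subset vert_self vert_in by blast
  moreover have "card (\<Union>v\<in>verts. {x\<in>v. x \<in> boundary S}) = (\<Sum>v\<in>verts. card {x\<in>v. x \<in> boundary S})"
  proof (rule card_UN_disjoint)
    show "\<forall>v\<in>verts. finite {x\<in>v. x \<in> boundary S}"
      using boundary_subset map_facts(1) by (auto intro: finite_subset[of _ D])
    show "\<forall>v\<in>verts. \<forall>w\<in>verts. v \<noteq> w \<longrightarrow> {x\<in>v. x \<in> boundary S} \<inter> {x\<in>w. x \<in> boundary S} = {}"
      using verts_disjoint by blast
  qed (rule finite_verts)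
  moreover have "(\<Sum>v\<in>verts. card {x\<in>v. x \<in> boundary S}) = (\<Sum>v\<in>verts. 2)"
    by (rule sum.cong) (auto elim!: vertsE simp: card_boundary_vert[OF assms])
  ultimately show ?thesis by simp
qed

lemma interior_inv: "S \<subseteq> D \<Longrightarrow> d \<in> interior_darts S \<Longrightarrow> \<alpha> d \<in> interior_darts S"
  by (auto simp: interior_darts_def inv_inv)

text \<open>Walking along the boundary, the faces met on one side are consecutively adjacent.\<close>
lemma ham_region_interior_connected:
  assumes "ham_region a b S"
  shows "dart_connected \<alpha> face (interior_darts S) (face ` S)"
proof -
  let ?R = "dart_rel \<alpha> face (interior_darts S)"
  have reg: "region a b S" and conn: "dart_connected \<alpha> vert (boundary S) verts"
    using assms by (auto simp: ham_region_def)
  have SD: "S \<subseteq> D" using reg by (rule region_subset)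
  have ID: "interior_darts S \<subseteq> D" using SD by (auto simp: interior_darts_def)
  note symR = dart_rel_rtrancl_sym[OF ID interior_inv[OF SD], where p = face]
  have next_face: "(face x, face (\<sigma> x)) \<in> ?R\<^sup>*" if "x \<in> S" "\<sigma> x \<in> S" for x
  proof -
    have "x \<in> interior_darts S" using that SD region_inv[OF reg] by (auto simp: interior_darts_def)
    from dart_relI[OF this, of face \<alpha>] show ?thesis using face_inv[of x] that(1) SD by auto
  qed
  \<comment> \<open>At a cubic vertex any two darts are equal or consecutive in one of the two
    directions.\<close>
  have same: "(face x, face y) \<in> ?R\<^sup>*" if xy: "x \<in> S" "y \<in> S" "vert x = vert y" for x y
  proof -
    have xD: "x \<in> D" using xy SD by auto
    have "y \<in> vert x" using xy(3) vert_self by simp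
    then show ?thesis
    proof (rule vert_memE[OF _ xD])
      assume "y = \<sigma> (\<sigma> x)"
      then have "\<sigma> y = x" using rot_cycle(4)[OF xD] by simp
      then have "(face y, face x) \<in> ?R\<^sup>*" using next_face[of y] xy by simp
      then show ?thesis using symR by blast
    qed (use next_face[of x] xy in auto)
  qed
  \<comment> \<open>Quantifying over all darts of the region at both end vertices makes the claim
    strong enough for induction along the boundary walk.\<close>
  have "\<forall>x\<in>S. \<forall>y\<in>S. vert x = u \<longrightarrow> vert y = v \<longrightarrow> (face x, face y) \<in> ?R\<^sup>*"
    if "(u, v) \<in> (dart_rel \<alpha> vert (boundary S))\<^sup>*" for u v
    using that
  proof (induction rule: rtrancl_induct)
    case base
    then show ?case using same by auto
  next
    case (step v w)
    then obtain d where d: "d \<in> boundary S" "v = vert d" "w = vert (\<alpha> d)" by (auto simp: dart_rel_def)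
    have dD: "d \<in> D" using d(1) boundary_subset by auto
    \<comment> \<open>The face of the region beside the boundary edge \<open>d\<close> has a dart at
      each end of it: \<open>d\<close> and \<open>\<sigma> (\<alpha> d)\<close> if it lies on the
      side of \<open>d\<close>, and \<open>\<sigma> d\<close> and \<open>\<alpha> d\<close> if it
      lies on the other side.\<close>
    obtain z z' where z: "z \<in> S" "z' \<in> S" "vert z = v" "vert z' = w" "face z = face z'"
    proof (cases "d \<in> S")
      case True
      then show ?thesis using that[of d "\<sigma> (\<alpha> d)"] d reg by (auto simp: region_def vert_rot face_step)
    next
      case False
      then have "\<alpha> d \<in> S" using d(1) by (auto simp: boundary_def)
      then show ?thesis using that[of "\<sigma> d" "\<alpha> d"] d region_inv[OF reg dD] face_inv[OF dD]
        by (auto simp: vert_rot)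
    qed
    show ?case
    proof (intro ballI impI)
      fix x y assume xy: "x \<in> S" "y \<in> S" "vert x = u" "vert y = w"
      have "(face x, face z) \<in> ?R\<^sup>*" using step.IH xy(1,3) z(1,3) by blast
      moreover have "(face z', face y) \<in> ?R\<^sup>*" using same[of z' y] xy z by auto
      ultimately show "(face x, face y) \<in> ?R\<^sup>*" using z(5) by auto
    qed
  qed
  then show ?thesis
    using conn vert_in SD unfolding dart_connected_def by blast
qed

section \<open>Hamiltonian cycles\<close>

lemma edge_of_inv: "d \<in> D \<Longrightarrow> edge_of \<alpha> (\<alpha> d) = edge_of \<alpha> d"
  by (simp add: edge_of_def inv_inv insert_commute)

text \<open>There are no loops, so different darts at a vertex belong to different edges.\<close>

lemma edges_inter_vert:
  assumes "B \<subseteq> D" "\<forall>d\<in>B. \<alpha> d \<in> B" "d \<in> D"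
  shows "card {e\<in>edge_of \<alpha> ` B. e \<inter> vert d \<noteq> {}} = card {x\<in>vert d. x \<in> B}"
proof -
  have "{e\<in>edge_of \<alpha> ` B. e \<inter> vert d \<noteq> {}} = edge_of \<alpha> ` {x\<in>vert d. x \<in> B}"
  proof (intro equalityI subsetI)
    fix e assume "e \<in> {e\<in>edge_of \<alpha> ` B. e \<inter> vert d \<noteq> {}}"
    then obtain x where x: "x \<in> B" "e = edge_of \<alpha> x" "x \<in> vert d \<or> \<alpha> x \<in> vert d"
      unfolding edge_of_def by fast
    moreover have "edge_of \<alpha> x = edge_of \<alpha> (\<alpha> x)"
      using edge_of_inv x(1) assms(1) by auto
    ultimately show "e \<in> edge_of \<alpha> ` {x\<in>vert d. x \<in> B}" using assms(2) by blast
  next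
    fix e assume "e \<in> edge_of \<alpha> ` {x\<in>vert d. x \<in> B}"
    then obtain x where "x \<in> vert d" "x \<in> B" "e = edge_of \<alpha> x" by blast
    moreover have "x \<in> edge_of \<alpha> x" by (simp add: edge_of_def)
    ultimately show "e \<in> {e\<in>edge_of \<alpha> ` B. e \<inter> vert d \<noteq> {}}" by blast
  qed
  moreover have "inj_on (edge_of \<alpha>) {x\<in>vert d. x \<in> B}"
  proof (rule inj_onI)
    fix x y assume xy: "x \<in> {x\<in>vert d. x \<in> B}" "y \<in> {x\<in>vert d. x \<in> B}" "edge_of \<alpha> x = edge_of \<alpha> y"
    then have "vert x = vert y" "x \<in> D" using vert_eq assms(1) by auto
    moreover have "y \<in> edge_of \<alpha> x" unfolding xy(3) by (simp add: edge_of_def)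
    ultimately show "x = y" using no_loop[of x] by (auto simp: edge_of_def)
  qed
  ultimately show ?thesis by (simp add: card_image)
qed

lemma edge_adj_rel:
  assumes "B \<subseteq> D" "\<forall>d\<in>B. \<alpha> d \<in> B"
  shows "{(u, w). u \<in> verts \<and> w \<in> verts \<and> u \<noteq> w \<and>
           (\<exists>e\<in>edge_of \<alpha> ` B. e \<inter> u \<noteq> {} \<and> e \<inter> w \<noteq> {})} = dart_rel \<alpha> vert B" (is "?L = ?R")
proof (intro equalityI subsetI)
  fix z assume "z \<in> ?L"
  then obtain u w x where x: "z = (u, w)" "u \<in> verts" "w \<in> verts" "u \<noteq> w" "x \<in> B"
      "{x, \<alpha> x} \<inter> u \<noteq> {}" "{x, \<alpha> x} \<inter> w \<noteq> {}" by (auto simp: edge_of_def)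
  then have "u = vert x \<or> u = vert (\<alpha> x)" "w = vert x \<or> w = vert (\<alpha> x)"
    using vertD by blast+
  then have "z = (vert x, vert (\<alpha> x)) \<or> z = (vert (\<alpha> x), vert (\<alpha> (\<alpha> x)))"
    using x(1,4,5) assms(1) by (auto simp: inv_inv)
  then show "z \<in> ?R" using dart_relI x(5) assms(2) by metis
next
  fix z assume "z \<in> ?R"
  then obtain x where x: "x \<in> B" "z = (vert x, vert (\<alpha> x))" by (auto simp: dart_rel_def)
  then have "x \<in> D" using assms(1) by auto
  moreover have "edge_of \<alpha> x \<in> edge_of \<alpha> ` B" "x \<in> edge_of \<alpha> x" "\<alpha> x \<in> edge_of \<alpha> x"
    using x(1) by (auto simp: edge_of_def)
  ultimately have "vert x \<in> verts" "vert (\<alpha> x) \<in> verts" "vert x \<noteq> vert (\<alpha> x)"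
    "edge_of \<alpha> x \<inter> vert x \<noteq> {}" "edge_of \<alpha> x \<inter> vert (\<alpha> x) \<noteq> {}"
    using vert_in inv_in no_loop[of x] vert_self[of x] vert_self[of "\<alpha> x"] by blast+
  then show "z \<in> ?L" using x by blast
qed

lemma ham_cycle_iff:
  assumes B: "B \<subseteq> D" "\<forall>d\<in>B. \<alpha> d \<in> B"
  shows "ham_cycle D \<alpha> \<sigma> (edge_of \<alpha> ` B) \<longleftrightarrow>
    (\<forall>d\<in>D. card {x\<in>vert d. x \<in> B} = 2) \<and> dart_connected \<alpha> vert B verts"
proof -
  have "edge_of \<alpha> ` B \<subseteq> map_edges D \<alpha>" using B(1) by (auto simp: map_edges_def)
  moreover have "(\<forall>v\<in>verts. card {e\<in>edge_of \<alpha> ` B. e \<inter> v \<noteq> {}} = 2) \<longleftrightarrow>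
      (\<forall>d\<in>D. card {x\<in>vert d. x \<in> B} = 2)"
    using edges_inter_vert[OF B] by (auto simp: map_verts_def)
  ultimately show ?thesis
    unfolding ham_cycle_def sg_connected_def dart_connected_def edge_adj_rel[OF B] by simp
qed

text \<open>From a cycle, the region of all faces that are not outside is taken. Crossing an edge
  off the cycle does not change sides, so its boundary lies in the cycle, and since both have two
  darts at every vertex they coincide. Conversely, a walk from the outer face that avoids the
  boundary never enters the region, and it reaches every face of the complement because the dual of
  the complement is connected.\<close>

theorem ham_cycle_iff_ham_region:
  assumes outer: "outer \<in> faces" "col outer = 3"
  shows "(\<exists>C. ham_cycle D \<alpha> \<sigma> C \<and>
             (\<forall>F\<in>faces. col F = 2 \<longrightarrow> F \<notin> outside_faces D \<alpha> \<sigma> C outer) \<and>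
             (\<forall>F\<in>faces. col F = 3 \<longrightarrow> F \<in> outside_faces D \<alpha> \<sigma> C outer))
         \<longleftrightarrow> (\<exists>S. ham_region 2 3 S)" (is "?L \<longleftrightarrow> ?R")
proof
  assume ?L
  then obtain C where C: "ham_cycle D \<alpha> \<sigma> C"
    and in2: "\<And>F. F \<in> faces \<Longrightarrow> col F = 2 \<Longrightarrow> F \<notin> outside_faces D \<alpha> \<sigma> C outer"
    and out3: "\<And>F. F \<in> faces \<Longrightarrow> col F = 3 \<Longrightarrow> F \<in> outside_faces D \<alpha> \<sigma> C outer" by blast
  define B where "B = {d\<in>D. edge_of \<alpha> d \<in> C}"
  have B: "B \<subseteq> D" by (auto simp: B_def)
  have clB: "\<alpha> d \<in> B" if "d \<in> B" for d
    using that by (auto simp: B_def inv_in inv_inv edge_of_def insert_commute)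
  have "C \<subseteq> map_edges D \<alpha>" using C by (simp add: ham_cycle_def)
  then have CB: "C = edge_of \<alpha> ` B" by (auto simp: B_def map_edges_def)
  have "\<forall>d\<in>B. \<alpha> d \<in> B" using clB by blast
  from ham_cycle_iff[OF B this] C CB
  have "\<forall>d\<in>D. card {x\<in>vert d. x \<in> B} = 2" and conn: "dart_connected \<alpha> vert B verts" by simp_all
  then have cB: "card {x\<in>vert d. x \<in> B} = 2" if "d \<in> D" for d using that by blast
  define S where "S = {d\<in>D. face d \<notin> outside_faces D \<alpha> \<sigma> C outer}"
  have reg: "region 2 3 S"
    unfolding region_def S_def using in2 out3 face_in by (auto simp: rot_in inv_in face_step)
  have sub: "boundary S \<subseteq> B"
  proof (rule subsetI, rule ccontr)
    fix d assume d: "d \<in> boundary S" "d \<notin> B"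
    have dD: "d \<in> D" using d boundary_subset by auto
    let ?R = "{(F1, F2). \<exists>d\<in>D. face d = F1 \<and> face (\<alpha> d) = F2 \<and> edge_of \<alpha> d \<notin> C}"
    have "(face d, face (\<alpha> d)) \<in> ?R" using d(2) dD by (auto simp: B_def)
    moreover have "(face (\<alpha> d), face d) \<in> ?R"
      using d(2) dD clB[of "\<alpha> d"] inv_in[OF dD] inv_inv[OF dD] by (auto simp: B_def intro!: bexI[of _ "\<alpha> d"])
    ultimately have "face d \<in> outside_faces D \<alpha> \<sigma> C outer \<longleftrightarrow> face (\<alpha> d) \<in> outside_faces D \<alpha> \<sigma> C outer"
      unfolding outside_faces_def by (auto intro: rtrancl_into_rtrancl)
    then show False using d(1) by (auto simp: boundary_def S_def inv_in)
  qed
  have "B \<subseteq> boundary S"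
  proof
    fix x assume x: "x \<in> B"
    then have xD: "x \<in> D" using B by auto
    have "{y\<in>vert x. y \<in> boundary S} = {y\<in>vert x. y \<in> B}"
      using sub cB[OF xD] card_boundary_vert[OF reg xD] rot_cycle(5)[OF xD]
      by (intro card_subset_eq) auto
    then show "x \<in> boundary S" using x vert_self by auto
  qed
  then have "boundary S = B" using sub by auto
  then show ?R using conn reg by (auto simp: ham_region_def)
next
  assume ?R
  then obtain S where S: "ham_region 2 3 S" by auto
  then have reg: "region 2 3 S" and conn: "dart_connected \<alpha> vert (boundary S) verts"
    by (auto simp: ham_region_def)
  let ?C = "edge_of \<alpha> ` boundary S"
  have inC: "edge_of \<alpha> d \<in> ?C \<longleftrightarrow> d \<in> boundary S" if "d \<in> D" for d
    using that boundary_inv boundary_subset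
    by (auto simp: edge_of_def doubleton_eq_iff)
  have ham: "ham_cycle D \<alpha> \<sigma> ?C"
    using ham_cycle_iff[OF boundary_subset] boundary_inv card_boundary_vert[OF reg] conn by simp
  let ?R = "{(F1, F2). \<exists>d\<in>D. face d = F1 \<and> face (\<alpha> d) = F2 \<and> edge_of \<alpha> d \<notin> ?C}"
  obtain o' where o': "o' \<in> D" "outer = face o'" using outer(1) by (rule facesE)
  have "o' \<notin> S" using reg outer(2) o' by (auto simp: region_def)
  have "\<exists>d\<in>D - S. F = face d" if "(outer, F) \<in> ?R\<^sup>*" for F
    using that
  proof (induction rule: rtrancl_induct)
    case base
    then show ?case using o' \<open>o' \<notin> S\<close> by auto
  next
    case (step F F')
    then obtain d x where d: "d \<in> D" "face d = F" "face (\<alpha> d) = F'" "d \<notin> boundary S"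
      and x: "x \<in> D - S" "F = face x" using inC by auto
    have "d \<notin> S" using region_face_eq[OF reg, of d x] d x by auto
    then have "\<alpha> d \<in> D - S" using d by (auto simp: boundary_def inv_in)
    then show ?case using d by auto
  qed
  then have 2: "F \<notin> outside_faces D \<alpha> \<sigma> ?C outer" if "F \<in> faces" "col F = 2" for F
    using that reg unfolding outside_faces_def region_def by auto
  have sub: "dart_rel \<alpha> face (interior_darts (D - S)) \<subseteq> ?R"
    using inC by (auto simp: dart_rel_def interior_darts_def boundary_def)
  have "dart_connected \<alpha> face (interior_darts (D - S)) (face ` (D - S))"
    using ham_region_interior_connected[OF ham_region_complement[OF S]] .
  then have 3: "F \<in> outside_faces D \<alpha> \<sigma> ?C outer" if "F \<in> faces" "col F = 3" for F
  proof -
    obtain x where x: "x \<in> D" "F = face x" using \<open>F \<in> faces\<close> by (rule facesE)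
    then have "x \<in> D - S" using reg \<open>col F = 3\<close> by (auto simp: region_def)
    then have "(outer, F) \<in> (dart_rel \<alpha> face (interior_darts (D - S)))\<^sup>*"
      using \<open>dart_connected \<alpha> face (interior_darts (D - S)) (face ` (D - S))\<close> x o' \<open>o' \<notin> S\<close>
      by (auto simp: dart_connected_def)
    then show ?thesis using rtrancl_mono[OF sub] by (auto simp: outside_faces_def)
  qed
  show ?L using ham 2 3 by blast
qed

section \<open>Spanning trees of faces\<close>

text \<open>The region and its complement both have connected duals, so each needs at least twice
  its number of faces minus two interior darts. By \<open>cN\<close> and \<open>cF\<close> the two
  bounds add up to exactly the number of interior darts available, so both are attained.\<close>

lemma ham_region_all_bridges:
  assumes "ham_region a b S"
  shows "all_bridges \<alpha> face (interior_darts S)"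
proof -
  have reg: "region a b S" using assms by (simp add: ham_region_def)
  have SD: "S \<subseteq> D" using reg by (rule region_subset)
  let ?N = "interior_darts S" and ?N' = "interior_darts (D - S)"
  let ?F = "face ` S" and ?F' = "face ` (D - S)"
  have fin: "finite ?F" "finite ?F'" "finite ?N" "finite ?N'" "finite (boundary S)"
    using SD map_facts(1) by (auto simp: interior_darts_def boundary_def intro: finite_subset)
  obtain d where "d \<in> D" using map_facts(2) by auto
  then obtain x y where "x \<in> D" "x \<in> S" "y \<in> D" "y \<notin> S"
    using region_vert[OF reg] vert_subset by (metis subsetD)
  then have ne: "?F \<noteq> {}" "?F' \<noteq> {}" by auto
  have "card D = card (?N \<union> ?N' \<union> boundary S)"
    using SD by (intro arg_cong[where f = card]) (auto simp: interior_darts_def boundary_def inv_in)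
  also have "\<dots> = card (?N \<union> ?N') + card (boundary S)"
    using fin by (intro card_Un_disjoint) (auto simp: interior_darts_def boundary_def)
  also have "card (?N \<union> ?N') = card ?N + card ?N'"
    using fin by (intro card_Un_disjoint) (auto simp: interior_darts_def)
  finally have cN: "card ?N + card ?N' = card verts" using card_verts card_boundary[OF reg] by simp
  have "face x \<noteq> face y" if "x \<in> S" "y \<in> D - S" for x y
    using that region_face_eq[OF reg, of x y] by auto
  then have disj: "?F \<inter> ?F' = {}" by auto
  have "card faces = card (?F \<union> ?F')"
    using SD by (intro arg_cong[where f = card]) (auto simp: map_faces_def)
  also have "\<dots> = card ?F + card ?F'"
    using fin(1,2) disj by (rule card_Un_disjoint)
  finally have cF: "2 * card ?F + 2 * card ?F' = card verts + 4" using euler_verts by simp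
  have "2 * card ?F \<le> card ?N + 2"
  proof (rule card_connected_ge[OF _ interior_inv[OF SD] fin(1) ne(1)])
    show "dart_connected \<alpha> face ?N ?F" by (rule ham_region_interior_connected[OF assms])
  qed (use SD in \<open>auto simp: interior_darts_def\<close>)
  moreover have "2 * card ?F' \<le> card ?N' + 2"
  proof (rule card_connected_ge[OF _ interior_inv[OF Diff_subset] fin(2) ne(2)])
    show "dart_connected \<alpha> face ?N' ?F'"
      by (rule ham_region_interior_connected[OF ham_region_complement[OF assms]])
  qed (auto simp: interior_darts_def)
  ultimately have tight: "card ?N + 2 \<le> 2 * card ?F" using cN cF by simp
  show ?thesis
  proof (rule tight_imp_all_bridges[OF _ interior_inv[OF SD] fin(1) ne(1) _ _ tight])
    show "dart_connected \<alpha> face ?N ?F" by (rule ham_region_interior_connected[OF assms])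
  qed (use SD in \<open>auto simp: interior_darts_def\<close>)
qed

text \<open>A vertex set closed under the boundary changes membership an even number of times around every
  face of the region, always at interior edges. These edges form an even subgraph of a forest.\<close>
lemma ham_regionI:
  assumes reg: "region a b S"
    and conn: "dart_connected \<alpha> face (interior_darts S) (face ` S)"
    and br: "all_bridges \<alpha> face (interior_darts S)"
  shows "ham_region a b S"
proof -
  let ?N = "interior_darts S"
  have SD: "S \<subseteq> D" using reg by (rule region_subset)
  have ND: "?N \<subseteq> D" using SD by (auto simp: interior_darts_def)
  have "dart_connected \<alpha> vert (boundary S) verts"
  proof (rule dart_connectedI)
    show "vert (\<alpha> d) \<in> verts" if "d \<in> boundary S" for d
      using that boundary_subset by (auto intro: vert_in inv_in)
    fix U assume U: "U \<subseteq> verts" "U \<noteq> {}"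
      and cl: "\<And>d. d \<in> boundary S \<Longrightarrow> vert d \<in> U \<Longrightarrow> vert (\<alpha> d) \<in> U"
    have bd: "vert d \<in> U \<longleftrightarrow> vert (\<alpha> d) \<in> U" if "d \<in> boundary S" for d
      using cl[OF that] cl[OF boundary_inv[OF that]] inv_inv[of d] that by (auto simp: boundary_def)
    let ?M = "{d\<in>?N. (vert d \<in> U) \<noteq> (vert (\<alpha> d) \<in> U)}"
    have "?M = {}"
    proof (rule even_subset_of_bridges_empty[OF ND interior_inv[OF SD] br])
      show "\<alpha> d \<in> ?M" if "d \<in> ?M" for d
        using that interior_inv[OF SD] ND by (auto simp: inv_inv)
      show "even (card {d\<in>?M. face d = F})" for F
      proof (cases "\<exists>e\<in>S. F = face e")
        case True
        then obtain e where e: "e \<in> S" "F = face e" by auto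
        have "{d\<in>?M. face d = F} = {x\<in>face e. (vert x \<in> U) \<noteq> (vert (\<sigma> (\<alpha> x)) \<in> U)}"
        proof (intro equalityI subsetI)
          fix x assume "x \<in> {d\<in>?M. face d = F}"
          then show "x \<in> {x\<in>face e. (vert x \<in> U) \<noteq> (vert (\<sigma> (\<alpha> x)) \<in> U)}"
            using e face_self[of x] by (simp add: vert_rot)
        next
          fix x assume x: "x \<in> {x\<in>face e. (vert x \<in> U) \<noteq> (vert (\<sigma> (\<alpha> x)) \<in> U)}"
          then have xU: "(vert x \<in> U) \<noteq> (vert (\<alpha> x) \<in> U)" and xF: "face x = F" and xS: "x \<in> S"
            using e face_eq region_face[OF reg, of x e] by (auto simp: vert_rot)
          have "x \<notin> boundary S" using xU bd by blast
          then have "x \<in> ?N" using xS SD by (auto simp: boundary_def interior_darts_def)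
          then show "x \<in> {d\<in>?M. face d = F}" using xU xF by simp
        qed
        then show ?thesis using even_card_face_changes[of e "\<lambda>x. vert x \<in> U"] e SD by auto
      next
        case False
        then have "{d\<in>?M. face d = F} = {}" by (auto simp: interior_darts_def)
        then show ?thesis by (metis card.empty even_zero)
      qed
    qed auto
    then have step: "vert d \<in> U \<longleftrightarrow> vert (\<alpha> d) \<in> U" if "d \<in> S" for d
      using that bd[of d] SD by (auto simp: interior_darts_def boundary_def)
    \<comment> \<open>No edge beside the region separates \<open>U\<close> from its complement any
      more, so membership in \<open>U\<close> is constant along each face of the region.\<close>
    have orb: "x \<in> S \<and> (vert x \<in> U \<longleftrightarrow> vert y \<in> U)" if "x \<in> orbit (\<sigma> \<circ> \<alpha>) y" "y \<in> S" for x y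
      using that(1)
    proof induction
      case base
      then show ?case using step[OF that(2)] reg that(2) by (auto simp: region_def vert_rot)
    next
      case (step z)
      then show ?case using \<open>\<And>d. d \<in> S \<Longrightarrow> _ d\<close> reg by (auto simp: region_def vert_rot)
    qed
    have const: "vert x \<in> U \<longleftrightarrow> vert y \<in> U" if "x \<in> S" "y \<in> S" "face x = face y" for x y
      using orb[of x y] that face_self[of x] by (auto simp: face_of_def)
    have ex: "\<exists>x\<in>S. v = vert x" if "v \<in> verts" for v
      using that region_vert[OF reg] vert_eq by (metis vertsE)
    obtain u where u: "u \<in> U" "u \<in> verts" using U by auto
    then obtain x where x: "x \<in> S" "u = vert x" using ex by auto
    \<comment> \<open>The faces of the region with a vertex in \<open>U\<close>. Constancy on faces
      carries this set across interior edges, so it contains every face of the region, and every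
      vertex lies on one of them.\<close>
    let ?G = "{face z | z. z \<in> S \<and> vert z \<in> U}"
    have "v \<in> U" if v: "v \<in> verts" for v
    proof -
      obtain y where y: "y \<in> S" "v = vert y" using ex v by auto
      have "face y \<in> ?G"
      proof (rule dart_connected_closed[OF conn])
        show "face x \<in> face ` S" "face y \<in> face ` S" "face x \<in> ?G" using x y u by auto
        fix d assume d: "d \<in> ?N" "face d \<in> ?G"
        then have "vert d \<in> U" using const by (auto simp: interior_darts_def)
        then show "face (\<alpha> d) \<in> ?G" using step d by (auto simp: interior_darts_def)
      qed
      then obtain z where "z \<in> S" "vert z \<in> U" "face y = face z" by auto
      then show ?thesis using const[of y z] y by simp
    qed
    then show "U = verts" using U by auto
  qed
  then show ?thesis using reg by (simp add: ham_region_def)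
qed

section \<open>The radial graph as the dual graph of a region\<close>

text \<open>Of any two darts at a cubic vertex, one follows the other in the rotation. So two
  different faces that meet at a vertex share an edge there, and radial incidence becomes adjacency
  in the dual.\<close>

lemma red_fv_iff:
  assumes "X \<in> faces" "F \<in> faces" "col X \<noteq> col F"
  shows "red_fv D \<sigma> F X \<longleftrightarrow> (\<exists>z\<in>D. face z = X \<and> face (\<alpha> z) = F)"
proof
  assume "red_fv D \<sigma> F X"
  then obtain d x y where d: "d \<in> D" "y \<in> vert d" "y \<in> F" "x \<in> vert d" "x \<in> X"
    by (auto simp: red_fv_def)
  then have D: "x \<in> D" "y \<in> D" and F: "face y = F" "face x = X" and "x \<in> vert y"
    using vert_subset faceD assms(1,2) vert_eq vert_self by auto
  from \<open>x \<in> vert y\<close> D(2) show "\<exists>z\<in>D. face z = X \<and> face (\<alpha> z) = F"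
  proof (rule vert_memE)
    assume "x = y" then show ?thesis using F assms(3) by auto
  next
    assume "x = \<sigma> y"
    then show ?thesis using D F by (intro bexI[of _ "\<alpha> y"]) (auto simp: face_inv inv_in inv_inv)
  next
    assume "x = \<sigma> (\<sigma> y)"
    then have "\<sigma> x = y" using rot_cycle(4) D by simp
    then show ?thesis using D F by (intro bexI[of _ x]) (auto simp: face_inv)
  qed
next
  assume "\<exists>z\<in>D. face z = X \<and> face (\<alpha> z) = F"
  then obtain z where z: "z \<in> D" "face z = X" "face (\<sigma> z) = F" by (auto simp: face_inv)
  then have "z \<in> vert z \<inter> X" "\<sigma> z \<in> vert z \<inter> F"
    using face_self[of z] face_self[of "\<sigma> z"] vert_self[of z] vert_self[of "\<sigma> z"] vert_rot by auto
  then show "red_fv D \<sigma> F X" using z(1) by (auto simp: red_fv_def)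
qed

text \<open>Inside a region, the \<open>a\<close>-faces are the vertices of the reduced graph and
  the remaining faces are its chosen faces. The injection records this role, so the dual of the
  region and the radial graph live on the same set of faces.\<close>

definition radial_node :: "nat \<Rightarrow> 'd set \<Rightarrow> 'd set + 'd set" where
  "radial_node a F = (if col F = a then Inl F else Inr F)"

definition node_face :: "'d set + 'd set \<Rightarrow> 'd set" where
  "node_face x = (case x of Inl F \<Rightarrow> F | Inr F \<Rightarrow> F)"

lemma node_face_radial_node: "node_face (radial_node a F) = F"
  by (auto simp: node_face_def radial_node_def)

lemma region_dcol: "region a b S \<Longrightarrow> d \<in> S \<Longrightarrow> dcol d = a \<or> dcol d = 1"
  using dcol_cases[of d] by (auto simp: region_def doubleton_eq_iff)

text \<open>The faces of a region have colour \<open>a\<close> or 1, and adjacent faces differ in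
  colour. Its dual is therefore bipartite with exactly the two classes of the radial graph.\<close>

lemma radial_adj_iff:
  assumes reg: "region a b S" and XY: "X \<in> face ` S" "Y \<in> face ` S"
  shows "radial_adj (red_fv D \<sigma>) (radial_node a X) (radial_node a Y) \<longleftrightarrow>
    (X, Y) \<in> dart_rel \<alpha> face (interior_darts S)"
proof -
  have SD: "S \<subseteq> D" using reg by (rule region_subset)
  have a1: "a \<noteq> 1" using region_cols[OF reg] by auto
  have F: "X \<in> faces" "Y \<in> faces" using XY SD by (auto intro: face_in)
  have rel: "(X, Y) \<in> dart_rel \<alpha> face (interior_darts S) \<longleftrightarrow> (\<exists>z\<in>D. face z = X \<and> face (\<alpha> z) = Y)"
  proof
    assume "\<exists>z\<in>D. face z = X \<and> face (\<alpha> z) = Y"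
    then obtain z where z: "z \<in> D" "face z = X" "face (\<alpha> z) = Y" by auto
    then have "z \<in> S" "\<alpha> z \<in> S" using XY region_face_eq[OF reg] by (metis imageE)+
    then show "(X, Y) \<in> dart_rel \<alpha> face (interior_darts S)"
      using z by (auto simp: dart_rel_def interior_darts_def)
  qed (use SD in \<open>auto simp: dart_rel_def interior_darts_def\<close>)
  have rev: "(\<exists>z\<in>D. face z = X \<and> face (\<alpha> z) = Y) \<longleftrightarrow> (\<exists>z\<in>D. face z = Y \<and> face (\<alpha> z) = X)"
    by (metis inv_in inv_inv)
  have same: "\<not> (\<exists>z\<in>D. face z = X \<and> face (\<alpha> z) = Y)" if "col X = col Y"
    using that dcol_inv_neq by metis
  have "col X = a \<or> col X = 1" "col Y = a \<or> col Y = 1" using XY region_dcol[OF reg] by auto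
  then show ?thesis
    using a1 red_fv_iff[OF F] red_fv_iff[OF F(2,1)] same unfolding rel
    by (auto simp: radial_adj_def radial_node_def rev)
qed

text \<open>Connectedness carries over along \<open>radial_node\<close>. For acyclicity the two
  notions could differ on closed walks with one or two vertices, which \<open>sg_acyclic\<close>
  ignores; the colouring excludes the first kind and \<open>common_edge_unique\<close> the
  second.\<close>

lemma sg_tree_iff:
  assumes reg: "region a b S"
  shows "sg_tree (radial_node a ` face ` S) (radial_adj (red_fv D \<sigma>)) \<longleftrightarrow>
    dart_connected \<alpha> face (interior_darts S) (face ` S) \<and> all_bridges \<alpha> face (interior_darts S)"
proof -
  let ?W = "radial_node a ` face ` S" and ?adj = "radial_adj (red_fv D \<sigma>)"
  let ?N = "interior_darts S" and ?F = "face ` S"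
  let ?R = "{(x, y). x \<in> ?W \<and> y \<in> ?W \<and> ?adj x y}"
  have SD: "S \<subseteq> D" using reg by (rule region_subset)
  have ND: "?N \<subseteq> D" using SD by (auto simp: interior_darts_def)
  have relF: "X \<in> ?F \<and> Y \<in> ?F" if "(X, Y) \<in> dart_rel \<alpha> face ?N" for X Y
    using that by (auto simp: dart_rel_def interior_darts_def)
  have up: "(radial_node a X, radial_node a Y) \<in> ?R" if "(X, Y) \<in> dart_rel \<alpha> face ?N" for X Y
    using that relF[OF that] radial_adj_iff[OF reg] by auto
  have down: "(node_face x, node_face y) \<in> dart_rel \<alpha> face ?N" if "(x, y) \<in> ?R" for x y
    using that radial_adj_iff[OF reg] by (auto simp: node_face_radial_node)
  obtain d where "d \<in> D" using map_facts(2) by auto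
  then have ne: "?W \<noteq> {}" using region_vert[OF reg] by (metis empty_iff image_is_empty)
  have conn: "sg_connected ?W ?adj \<longleftrightarrow> dart_connected \<alpha> face ?N ?F"
  proof
    assume c: "sg_connected ?W ?adj"
    show "dart_connected \<alpha> face ?N ?F" unfolding dart_connected_def
    proof (intro ballI)
      fix X Y assume "X \<in> ?F" "Y \<in> ?F"
      then have "(radial_node a X, radial_node a Y) \<in> ?R\<^sup>*" using c by (auto simp: sg_connected_def)
      then have "(node_face (radial_node a X), node_face (radial_node a Y)) \<in> (dart_rel \<alpha> face ?N)\<^sup>*"
      proof (induction rule: rtrancl_induct)
        case (step y z)
        show ?case using step.IH down[OF step(2)] by (rule rtrancl_into_rtrancl)
      qed simp
      then show "(X, Y) \<in> (dart_rel \<alpha> face ?N)\<^sup>*" by (simp add: node_face_radial_node)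
    qed
  next
    assume c: "dart_connected \<alpha> face ?N ?F"
    have "(radial_node a X, radial_node a Y) \<in> ?R\<^sup>*" if "X \<in> ?F" "Y \<in> ?F" for X Y
    proof -
      have "(X, Y) \<in> (dart_rel \<alpha> face ?N)\<^sup>*" using c that by (auto simp: dart_connected_def)
      then show ?thesis
      proof (induction rule: rtrancl_induct)
        case (step Y Z)
        show ?case using step.IH up[OF step(2)] by (rule rtrancl_into_rtrancl)
      qed simp
    qed
    then show "sg_connected ?W ?adj" by (auto simp: sg_connected_def)
  qed
  have "sg_acyclic ?W ?adj \<longleftrightarrow> all_bridges \<alpha> face ?N"
  proof
    assume br: "all_bridges \<alpha> face ?N"
    show "sg_acyclic ?W ?adj" unfolding sg_acyclic_def
    proof (intro notI, elim exE conjE)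
      fix cyc assume cyc: "3 \<le> length cyc" "distinct cyc" "set cyc \<subseteq> ?W"
        "\<forall>i<length cyc. ?adj (cyc ! i) (cyc ! ((i + 1) mod length cyc))"
      show False
      proof (rule all_bridges_no_cycle[OF ND interior_inv[OF SD] br])
        show "length (map node_face cyc) \<ge> 3" using cyc(1) by simp
        have "inj_on node_face ?W" by (rule inj_onI) (auto simp: node_face_radial_node)
        then show "distinct (map node_face cyc)"
          using cyc(2,3) by (simp add: distinct_map inj_on_subset)
        fix i assume i: "i < length (map node_face cyc)"
        let ?j = "(i + 1) mod length cyc"
        have j: "?j < length cyc" using i by (intro mod_less_divisor) auto
        have "cyc ! i \<in> ?W" "cyc ! ?j \<in> ?W" using cyc(3) i j nth_mem by auto
        then have "(cyc ! i, cyc ! ?j) \<in> ?R" using cyc(4) i by simp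
        from down[OF this] obtain d where "d \<in> ?N" "face d = node_face (cyc ! i)"
          "face (\<alpha> d) = node_face (cyc ! ?j)" by (auto simp: dart_rel_def)
        then show "\<exists>d\<in>?N. face d = map node_face cyc ! i \<and>
            face (\<alpha> d) = map node_face cyc ! ((i + 1) mod length (map node_face cyc))"
          using i j by auto
      qed
    qed
  next
    assume ac: "sg_acyclic ?W ?adj"
    show "all_bridges \<alpha> face ?N" unfolding all_bridges_def
    proof (intro ballI notI)
      fix d assume d: "d \<in> ?N" and alt: "(face d, face (\<alpha> d)) \<in> (dart_rel \<alpha> face (?N - {d, \<alpha> d}))\<^sup>*"
      have dD: "d \<in> D" using d ND by auto
      let ?Q = "dart_rel \<alpha> face (?N - {d, \<alpha> d})"
      obtain xs where xs: "xs \<noteq> []" "hd xs = face d" "last xs = face (\<alpha> d)" "distinct xs"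
          "successively (\<lambda>u v. (u, v) \<in> ?Q) xs"
        using rtrancl_imp_distinct_path[OF alt] by auto
      let ?n = "length xs"
      have ends: "xs ! 0 = face d" "xs ! (?n - 1) = face (\<alpha> d)"
        using xs(1-3) by (simp_all add: hd_conv_nth last_conv_nth)
      have st: "(xs ! i, xs ! Suc i) \<in> ?Q" if "Suc i < ?n" for i
        using xs(5) that by (auto simp: successively_conv_nth)
      have QN: "?Q \<subseteq> dart_rel \<alpha> face ?N" by (rule dart_rel_mono) auto
      have close: "(face (\<alpha> d), face d) \<in> dart_rel \<alpha> face ?N"
        using dart_relI[OF interior_inv[OF SD d], of face \<alpha>] dD by (simp add: inv_inv)
      have n1: "?n \<noteq> 1" using ends dcol_inv_neq[OF dD] by auto
      have n2: "?n \<noteq> 2"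
      proof
        assume "?n = 2"
        then have "(face d, face (\<alpha> d)) \<in> ?Q" using st[of 0] ends by simp
        then obtain z where z: "z \<in> ?N - {d, \<alpha> d}" "face z = face d" "face (\<alpha> z) = face (\<alpha> d)"
          by (auto simp: dart_rel_def)
        then show False using common_edge_unique[of d z] dD ND by auto
      qed
      have "?n \<noteq> 0" using xs(1) by simp
      then have len: "?n \<ge> 3" using n1 n2 by linarith
      have cyc: "(xs ! i, xs ! ((i + 1) mod ?n)) \<in> dart_rel \<alpha> face ?N" if i: "i < ?n" for i
      proof (cases "Suc i < ?n")
        case True then show ?thesis using subsetD[OF QN st[OF True]] by simp
      next
        case False
        then have "Suc i = ?n" using i by simp
        then have "i = ?n - 1" "(i + 1) mod ?n = 0" by simp_all
        then show ?thesis using close ends by simp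
      qed
      have sF: "set xs \<subseteq> ?F"
      proof
        fix X assume "X \<in> set xs"
        then obtain i where "i < ?n" "X = xs ! i" by (auto simp: in_set_conv_nth)
        then show "X \<in> ?F" using relF[OF cyc] by blast
      qed
      have inj: "inj_on (radial_node a) A" for A by (rule inj_onI) (metis node_face_radial_node)
      let ?c = "map (radial_node a) xs"
      have "\<forall>i<length ?c. ?adj (?c ! i) (?c ! ((i + 1) mod length ?c))"
      proof (intro allI impI)
        fix i assume i: "i < length ?c"
        then have j: "(i + 1) mod ?n < ?n" using xs(1) by auto
        have "(radial_node a (xs ! i), radial_node a (xs ! ((i + 1) mod ?n))) \<in> ?R"
          using i by (intro up cyc) simp
        then show "?adj (?c ! i) (?c ! ((i + 1) mod length ?c))" using i j by simp
      qed
      moreover have "distinct ?c" using xs(4) inj by (simp add: distinct_map)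
      moreover have "set ?c \<subseteq> ?W" using sF by auto
      moreover have "length ?c \<ge> 3" using len by simp
      ultimately show False using ac unfolding sg_acyclic_def by blast
    qed
  qed
  then show ?thesis using conn ne by (simp add: sg_tree_def)
qed

lemma colour_adjacent_dart:
  assumes "a \<noteq> b" "a \<in> {1, 2, 3}" "b \<in> {1, 2, 3}"
  obtains d where "d \<in> D" "dcol d = b" "dcol (\<alpha> d) = a"
proof -
  obtain e where "e \<in> D" using map_facts(2) by auto
  then obtain x where x: "x \<in> D" "dcol x = b" using vert_colour assms(3) by metis
  have D: "\<sigma> x \<in> D" "\<sigma> (\<sigma> x) \<in> D" using x by (auto simp: rot_in)
  have "dcol (\<sigma> x) = a \<or> dcol (\<sigma> (\<sigma> x)) = a"
    using dcol_rot_neq[OF x(1)] dcol_cases[OF x(1)] dcol_cases[OF D(1)] dcol_cases[OF D(2)]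
      assms x(2) by auto
  then show ?thesis
  proof
    assume "dcol (\<sigma> x) = a"
    then show ?thesis using that[of x] x by (simp add: dcol_inv)
  next
    assume "dcol (\<sigma> (\<sigma> x)) = a"
    then show ?thesis using that[of "\<alpha> (\<sigma> (\<sigma> x))"] x D rot_cycle(4)[OF x(1)]
      by (simp add: inv_in inv_inv face_inv)
  qed
qed

text \<open>Around a face, the faces across successive edges alternate between the two other
  colours.\<close>

lemma dcol_face_step2:
  assumes "d \<in> D" shows "dcol (\<alpha> (\<sigma> (\<alpha> (\<sigma> (\<alpha> d))))) = dcol (\<alpha> d)"
proof -
  let ?e = "\<sigma> (\<alpha> d)"
  have D: "\<alpha> d \<in> D" "?e \<in> D" "\<sigma> ?e \<in> D" "\<alpha> ?e \<in> D" "\<sigma> (\<alpha> ?e) \<in> D" "\<sigma> (\<sigma> (\<alpha> ?e)) \<in> D"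
    using assms by (auto simp: inv_in rot_in)
  have 1: "dcol ?e = dcol d" "dcol (\<sigma> (\<alpha> ?e)) = dcol d" by (simp_all add: face_step)
  have 2: "dcol (\<alpha> ?e) = dcol (\<sigma> ?e)" using D by (simp add: face_inv)
  have 3: "dcol (\<alpha> (\<sigma> (\<alpha> ?e))) = dcol (\<sigma> (\<sigma> (\<alpha> ?e)))" using D by (simp add: face_inv)
  show ?thesis
    using dcol_rot_neq[OF D(1)] dcol_rot_neq[OF D(4)] 1 2 3 dcol_cases[OF assms]
      dcol_cases[OF D(1)] dcol_cases[OF D(4)] dcol_cases[OF D(6)] by auto
qed

text \<open>Two edges of a \<open>b\<close>-face that are two steps apart both border
  \<open>a\<close>-faces. They are different edges by \<open>face_step2_neq\<close>, so these
  \<open>a\<close>-faces differ, as otherwise two faces would share two edges.\<close>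

lemma other_face_of_colour:
  assumes ab: "{a, b} = {2, 3 :: nat}" and X: "X \<in> faces"
  obtains Y where "Y \<in> faces" "col Y = a" "Y \<noteq> X"
proof -
  have "a \<noteq> b" "a \<in> {1, 2, 3}" "b \<in> {1, 2, 3}" using ab by (auto simp: doubleton_eq_iff)
  then obtain d where d: "d \<in> D" "dcol d = b" "dcol (\<alpha> d) = a" by (rule colour_adjacent_dart)
  let ?e = "\<sigma> (\<alpha> (\<sigma> (\<alpha> d)))"
  have e: "?e \<in> D" "\<alpha> ?e \<in> D" "\<alpha> d \<in> D" using d by (auto simp: rot_in inv_in)
  have "dcol (\<alpha> ?e) = a" using dcol_face_step2[OF d(1)] d(3) by simp
  moreover have "face (\<alpha> ?e) \<noteq> face (\<alpha> d)"
    using common_edge_unique[OF d(1) e(1)] face_step2_neq[OF d(1)] by (auto simp: face_step)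
  ultimately show ?thesis
    using that[of "face (\<alpha> ?e)"] that[of "face (\<alpha> d)"] face_in e d(3) by metis
qed

text \<open>A set of 1-faces corresponds to the region formed by it and all \<open>a\<close>-faces,
  and \<open>sg_tree_iff\<close> translates the tree condition. The other requirements follow from
  the colours: 1-faces never share an edge, the outer face is not a 1-face, and every
  \<open>a\<close>-face has a neighbour in the tree because there is a second
  \<open>a\<close>-face.\<close>

theorem reduced_has_sptf_iff_ham_region:
  assumes outer: "col outer = 3" and ab: "{a, b} = {2, 3 :: nat}"
  shows "reduced_has_sptf D \<alpha> \<sigma> col outer a 1 \<longleftrightarrow> (\<exists>S. ham_region a b S)" (is "?L \<longleftrightarrow> ?R")
proof -
  let ?V = "red_verts D \<alpha> \<sigma> col a"
  have a: "a \<noteq> 1" "b \<noteq> 1" "a \<noteq> b" using ab by (auto simp: doubleton_eq_iff)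
  have nodes: "radial_node a ` (?V \<union> T) = Inl ` ?V \<union> Inr ` T" if "\<forall>F\<in>T. col F = 1" for T
    using that a(1) by (auto simp: radial_node_def red_verts_def image_Un intro!: image_cong)
  show ?thesis
  proof
    assume ?L
    then obtain T where T: "is_spanning_tree_of_faces ?V (red_faces D \<alpha> \<sigma> col a)
        (red_fe D \<alpha> \<sigma> col a) (red_fv D \<sigma>) outer T" "\<forall>F\<in>T. col F = 1"
      by (auto simp: reduced_has_sptf_def)
    have TF: "T \<subseteq> faces" using T(1) by (auto simp: is_spanning_tree_of_faces_def red_faces_def)
    define S where "S = {d\<in>D. dcol d = a \<or> face d \<in> T}"
    have reg: "region a b S"
      using ab a T(2) by (auto simp: region_def S_def rot_in inv_in face_step)
    have FS: "face ` S = ?V \<union> T"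
    proof (intro equalityI subsetI)
      fix F assume F: "F \<in> ?V \<union> T"
      then have "F \<in> faces" using TF by (auto simp: red_verts_def)
      then obtain d where "d \<in> D" "F = face d" by (rule facesE)
      then show "F \<in> face ` S" using F by (auto simp: S_def red_verts_def)
    qed (auto simp: S_def red_verts_def face_in)
    have "sg_tree (radial_node a ` face ` S) (radial_adj (red_fv D \<sigma>))"
      using T by (simp add: FS nodes is_spanning_tree_of_faces_def)
    then show ?R using ham_regionI[OF reg] sg_tree_iff[OF reg] by blast
  next
    assume ?R
    then obtain S where S: "ham_region a b S" by auto
    then have reg: "region a b S" by (simp add: ham_region_def)
    have SD: "S \<subseteq> D" using reg by (rule region_subset)
    define T where "T = {F \<in> face ` S. col F = 1}"
    have T1: "\<forall>F\<in>T. col F = 1" by (auto simp: T_def)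
    have TF: "T \<subseteq> faces" using SD by (auto simp: T_def intro: face_in)
    have FS: "face ` S = ?V \<union> T"
    proof (intro equalityI subsetI)
      fix F assume "F \<in> face ` S"
      then show "F \<in> ?V \<union> T" using region_dcol[OF reg] SD by (auto simp: T_def red_verts_def intro: face_in)
    next
      fix F assume "F \<in> ?V \<union> T"
      then show "F \<in> face ` S" using reg by (auto simp: T_def red_verts_def region_def elim!: facesE)
    qed
    have conn: "dart_connected \<alpha> face (interior_darts S) (face ` S)"
      using S by (rule ham_region_interior_connected)
    have tree: "sg_tree (Inl ` ?V \<union> Inr ` T) (radial_adj (red_fv D \<sigma>))"
      using sg_tree_iff[OF reg] conn ham_region_all_bridges[OF S] by (simp add: FS nodes T1)
    have sub: "T \<subseteq> red_faces D \<alpha> \<sigma> col a - {outer}"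
      using T1 TF a(1) outer by (auto simp: red_faces_def)
    have disj: "\<not> (\<exists>e. red_fe D \<alpha> \<sigma> col a f e \<and> red_fe D \<alpha> \<sigma> col a f' e)"
      if f: "f \<in> T" "f' \<in> T" "f \<noteq> f'" for f f'
    proof
      assume "\<exists>e. red_fe D \<alpha> \<sigma> col a f e \<and> red_fe D \<alpha> \<sigma> col a f' e"
      then obtain d where d: "d \<in> D" "{d, \<alpha> d} \<inter> f \<noteq> {}" "{d, \<alpha> d} \<inter> f' \<noteq> {}"
        by (auto simp: red_fe_def red_edges_def map_edges_def edge_of_def)
      have F: "f \<in> faces" "f' \<in> faces" using f TF by auto
      have "f = face d \<or> f = face (\<alpha> d)" "f' = face d \<or> f' = face (\<alpha> d)"
        using faceD[OF F(1)] faceD[OF F(2)] d by blast+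
      then have "dcol d = 1" "dcol (\<alpha> d) = 1" using f T1 by metis+
      then show False using dcol_inv_neq[OF d(1)] by simp
    qed
    have cover: "\<exists>F\<in>T. red_fv D \<sigma> F X" if X: "X \<in> ?V" for X
    proof -
      have XF: "X \<in> faces" "col X = a" using X by (auto simp: red_verts_def)
      \<comment> \<open>A target different from \<open>X\<close> makes the connecting path
        nontrivial; its first step leads to a face of colour 1.\<close>
      obtain Y where Y: "Y \<in> faces" "col Y = a" "Y \<noteq> X" using other_face_of_colour[OF ab XF(1)] .
      have "X \<in> face ` S" "Y \<in> face ` S" using FS XF Y by (auto simp: red_verts_def)
      then have "(X, Y) \<in> (dart_rel \<alpha> face (interior_darts S))\<^sup>*"
        using conn by (auto simp: dart_connected_def)
      then obtain Z where "(X, Z) \<in> dart_rel \<alpha> face (interior_darts S)"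
        using Y(3) by (auto elim: converse_rtranclE)
      then obtain z where z: "z \<in> S" "\<alpha> z \<in> S" "face z = X" by (auto simp: dart_rel_def interior_darts_def)
      have zD: "z \<in> D" using z SD by auto
      have c1: "dcol (\<alpha> z) = 1" using region_dcol[OF reg z(2)] dcol_inv_neq[OF zD] z(3) XF(2) by auto
      then have "face (\<alpha> z) \<in> T" using z by (auto simp: T_def)
      moreover have "red_fv D \<sigma> (face (\<alpha> z)) X"
        using red_fv_iff[OF XF(1) face_in[OF inv_in[OF zD]]] XF(2) a(1) c1 zD z(3) by auto
      ultimately show ?thesis by auto
    qed
    show ?L unfolding reduced_has_sptf_def is_spanning_tree_of_faces_def
      using sub disj cover tree T1 by (intro exI[of _ T]) blast
  qed
qed

section \<open>A-trails\<close>

text \<open>Darts of the edges separating a 2-face from a 3-face, i.e. of the edges of the reduced graph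
  obtained by contracting the 1-faces; \<open>apex d\<close> is the 1-face at the starting vertex of \<open>d\<close>.\<close>

definition trail_darts :: "'d set" where
  "trail_darts = {d\<in>D. dcol d \<noteq> 1 \<and> dcol (\<alpha> d) \<noteq> 1}"

definition apex :: "'d \<Rightarrow> 'd set" where
  "apex d = face (\<sigma> (\<sigma> d))"

lemma trail_darts_inv: "d \<in> trail_darts \<Longrightarrow> \<alpha> d \<in> trail_darts"
  by (auto simp: trail_darts_def inv_in inv_inv)

lemma trail_darts_in: "d \<in> trail_darts \<Longrightarrow> d \<in> D"
  by (simp add: trail_darts_def)

text \<open>The two sides of \<open>d\<close> are the faces of \<open>d\<close> and
  \<open>\<sigma> d\<close>, so the third face at the vertex has the remaining colour.\<close>

lemma trail_darts_iff: "d \<in> D \<Longrightarrow> d \<in> trail_darts \<longleftrightarrow> dcol (\<sigma> (\<sigma> d)) = 1"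
  using dcol_rot_neq[of d] dcol_cases[of d] dcol_cases[of "\<sigma> d"] dcol_cases[of "\<sigma> (\<sigma> d)"]
  by (auto simp: trail_darts_def dcol_inv rot_in)

lemma trail_dart_cols:
  "d \<in> trail_darts \<Longrightarrow> dcol d = 2 \<and> dcol (\<alpha> d) = 3 \<or> dcol d = 3 \<and> dcol (\<alpha> d) = 2"
  using dcol_cases[of d] dcol_cases[of "\<alpha> d"] dcol_inv_neq[of d] by (auto simp: trail_darts_def inv_in)

text \<open>Together with \<open>trail_dart_at_vert\<close>, this says that the edges between
  2-faces and 3-faces form a perfect matching: at each vertex it consists of the one edge opposite
  the 1-face.\<close>

lemma trail_dart_unique:
  assumes "x \<in> trail_darts" "y \<in> trail_darts" "vert x = vert y" shows "x = y"
proof -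
  have D: "x \<in> D" "y \<in> D" using assms trail_darts_in by auto
  have "y \<in> vert x" using assms(3) vert_self by simp
  then show ?thesis
  proof (rule vert_memE[OF _ D(1)])
    assume "y = \<sigma> x"
    then have "dcol (\<sigma> (\<sigma> y)) = dcol x" using rot_cycle(4) D by simp
    then show ?thesis using assms D trail_darts_iff[of y] by (simp add: trail_darts_def)
  next
    assume "y = \<sigma> (\<sigma> x)"
    then show ?thesis using assms D trail_darts_iff[of x] by (simp add: trail_darts_def)
  qed simp
qed

lemma trail_dart_at_vert:
  assumes "v \<in> verts" obtains d where "d \<in> trail_darts" "vert d = v"
proof -
  obtain e where e: "e \<in> D" "v = vert e" using assms by (rule vertsE)
  have "(1::nat) \<in> {1, 2, 3}" by simp
  from vert_colour[OF e(1) this] obtain x where x: "x \<in> D" "vert x = vert e" "dcol x = 1" .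
  then have "\<sigma> x \<in> trail_darts" using trail_darts_iff[of "\<sigma> x"] rot_cycle(4) by (simp add: rot_in)
  then show ?thesis using that x e by (simp add: vert_rot)
qed

lemma red_edges_eq: "red_edges D \<alpha> \<sigma> col 1 = edge_of \<alpha> ` trail_darts"
proof -
  have "(\<forall>F\<in>faces. col F = 1 \<longrightarrow> edge_of \<alpha> d \<inter> F = {}) \<longleftrightarrow> d \<in> trail_darts" if d: "d \<in> D" for d
  proof
    assume *: "\<forall>F\<in>faces. col F = 1 \<longrightarrow> edge_of \<alpha> d \<inter> F = {}"
    have "d \<in> edge_of \<alpha> d \<inter> face d" "\<alpha> d \<in> edge_of \<alpha> d \<inter> face (\<alpha> d)"
      using face_self by (auto simp: edge_of_def)
    then show "d \<in> trail_darts"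
      using * face_in[OF d] face_in[OF inv_in[OF d]] d unfolding trail_darts_def by blast
  next
    assume "d \<in> trail_darts"
    then show "\<forall>F\<in>faces. col F = 1 \<longrightarrow> edge_of \<alpha> d \<inter> F = {}"
      using faceD by (fastforce simp: trail_darts_def edge_of_def)
  qed
  then show ?thesis unfolding red_edges_def map_edges_def trail_darts_def by blast
qed

lemma red_ends_eq:
  assumes "d \<in> trail_darts" shows "red_ends D \<alpha> \<sigma> col 1 (edge_of \<alpha> d) = {apex d, apex (\<alpha> d)}"
proof -
  have *: "X \<in> red_verts D \<alpha> \<sigma> col 1 \<and> X \<inter> vert x \<noteq> {} \<longleftrightarrow> X = apex x" if x: "x \<in> trail_darts" for x X
  proof -
    have xD: "x \<in> D" using x by (rule trail_darts_in)
    have c: "dcol (\<sigma> (\<sigma> x)) = 1" "dcol x \<noteq> 1" "dcol (\<sigma> x) \<noteq> 1"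
      using x xD trail_darts_iff[OF xD] by (auto simp: trail_darts_def dcol_inv)
    have self: "\<sigma> (\<sigma> x) \<in> apex x" using face_self by (simp add: apex_def)
    show ?thesis
    proof
      assume X: "X \<in> red_verts D \<alpha> \<sigma> col 1 \<and> X \<inter> vert x \<noteq> {}"
      then obtain y where y: "y \<in> X" "y \<in> vert x" by auto
      then have "X = face y" "dcol y = 1" using X faceD by (auto simp: red_verts_def)
      with y(2) xD show "X = apex x" using c by (auto elim!: vert_memE simp: apex_def)
    next
      assume "X = apex x"
      then show "X \<in> red_verts D \<alpha> \<sigma> col 1 \<and> X \<inter> vert x \<noteq> {}"
        using self rot_cycle(5)[OF xD] c(1) face_in xD by (auto simp: red_verts_def apex_def rot_in)
    qed
  qed
  have "red_ends D \<alpha> \<sigma> col 1 (edge_of \<alpha> d) =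
      {X. (X \<in> red_verts D \<alpha> \<sigma> col 1 \<and> X \<inter> vert d \<noteq> {}) \<or>
          (X \<in> red_verts D \<alpha> \<sigma> col 1 \<and> X \<inter> vert (\<alpha> d) \<noteq> {})}"
    unfolding red_ends_def edge_of_def by blast
  then show ?thesis using *[OF assms] *[OF trail_darts_inv[OF assms]] by auto
qed

text \<open>Here \<open>z\<close> is the edge at the start of \<open>x\<close> along which the side
  \<open>f\<close> of \<open>x\<close> meets the 1-face. Fixing its direction by
  \<open>face z = f\<close> leaves open at which end of \<open>z\<close> the dart \<open>x\<close>
  starts. Since two faces share at most one edge, \<open>f\<close> and the 1-face determine
  \<open>z\<close>.\<close>

lemma trail_dart_corner:
  assumes x: "x \<in> trail_darts" and f: "f = face x \<or> f = face (\<alpha> x)"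
  obtains z where "z \<in> D" "face z = f" "face (\<alpha> z) = apex x" "vert x \<in> {vert z, vert (\<alpha> z)}"
proof -
  have xD: "x \<in> D" "\<sigma> x \<in> D" "\<sigma> (\<sigma> x) \<in> D" using x by (auto simp: rot_in trail_darts_in)
  from f show ?thesis
  proof
    assume "f = face x"
    moreover have "face (\<alpha> (\<sigma> (\<sigma> x))) = face x" using xD rot_cycle(4) by (simp add: face_inv)
    ultimately show ?thesis
      using that[of "\<alpha> (\<sigma> (\<sigma> x))"] xD by (simp add: inv_in inv_inv apex_def vert_rot)
  next
    assume "f = face (\<alpha> x)"
    then show ?thesis using that[of "\<sigma> x"] xD by (simp add: face_inv apex_def vert_rot)
  qed
qed

section \<open>From an A-trail to a region\<close>

text \<open>Between consecutive trail edges lies an edge \<open>z i\<close> of the 1-face that the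
  trail passes through. Trail edges and these links form one closed walk through all vertices of the
  cubic graph. The links take every second edge of each 1-face, which is what allows the walk to
  bound a region.\<close>

lemma A_trail_imp_ham_region:
  assumes "reduced_has_A_trail D \<alpha> \<sigma> col 1"
  shows "\<exists>S. ham_region 2 3 S"
proof -
  obtain es vs where "is_A_trail (red_verts D \<alpha> \<sigma> col 1) (red_edges D \<alpha> \<sigma> col 1)
      (red_ends D \<alpha> \<sigma> col 1) (red_faces D \<alpha> \<sigma> col 1) (red_fe D \<alpha> \<sigma> col 1) es vs"
    using assms by (auto simp: reduced_has_A_trail_def has_A_trail_def)
  then have es: "distinct es" "set es = edge_of \<alpha> ` trail_darts"
    and ends: "\<And>i. i < length es \<Longrightarrow>
      red_ends D \<alpha> \<sigma> col 1 (es ! i) = {vs ! i, vs ! ((i + 1) mod length es)}"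
    and common: "\<And>i. i < length es \<Longrightarrow> \<exists>f\<in>red_faces D \<alpha> \<sigma> col 1. red_fe D \<alpha> \<sigma> col 1 f (es ! i) \<and>
        red_fe D \<alpha> \<sigma> col 1 f (es ! ((i + 1) mod length es))"
    by (simp_all add: is_A_trail_def Let_def red_edges_eq[simplified])
  define m where "m = length es"
  define s where "s i = (i + 1) mod m" for i
  have m2: "m \<ge> 2"
  proof -
    obtain e where "e \<in> D" using map_facts(2) by auto
    then obtain d where d: "d \<in> trail_darts" using trail_dart_at_vert vert_in by metis
    \<comment> \<open>By alternation, two steps along a 2-face or 3-face lead from one trail edge to
      another.\<close>
    let ?d = "\<sigma> (\<alpha> (\<sigma> (\<alpha> d)))"
    have dD: "d \<in> D" "?d \<in> D" using d by (auto simp: trail_darts_in rot_in inv_in)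
    have d': "?d \<in> trail_darts"
      using d dD dcol_face_step2[OF dD(1)] by (simp add: trail_darts_def face_step)
    have "?d \<noteq> d" "?d \<noteq> \<alpha> d" using face_step2_neq[OF dD(1)] dcol_inv_neq[OF dD(1)] face_step by metis+
    then have "edge_of \<alpha> d \<noteq> edge_of \<alpha> ?d" by (auto simp: edge_of_def)
    moreover have "{edge_of \<alpha> d, edge_of \<alpha> ?d} \<subseteq> set es" using d d' es(2) by auto
    ultimately have "2 \<le> card (set es)" using card_mono[of "set es" "{edge_of \<alpha> d, edge_of \<alpha> ?d}"] by auto
    then show ?thesis using card_length[of es] by (simp add: m_def)
  qed
  have s_lt: "s i < m" for i using m2 by (simp add: s_def)
  have s_inj: "i = j" if "i < m" "j < m" "s i = s j" for i j
    using that by (auto simp: s_def mod_Suc split: if_splits)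
  have s_surj: "\<exists>j<m. s j = i" if "i < m" for i
  proof (cases i)
    case 0
    then show ?thesis using m2 by (intro exI[of _ "m - 1"]) (simp add: s_def)
  next
    case (Suc n)
    then show ?thesis using that by (intro exI[of _ n]) (simp add: s_def)
  qed
  \<comment> \<open>Each edge is directed so that its ends appear in the order in which the trail
    visits them.\<close>
  have "\<forall>i\<in>{..<m}. \<exists>x. x \<in> trail_darts \<and> es ! i = edge_of \<alpha> x \<and> apex x = vs ! i \<and> apex (\<alpha> x) = vs ! s i"
  proof
    fix i assume "i \<in> {..<m}"
    then have i: "i < length es" by (simp add: m_def)
    then obtain d where d: "d \<in> trail_darts" "es ! i = edge_of \<alpha> d" using es(2) nth_mem by blast
    then have "{apex d, apex (\<alpha> d)} = {vs ! i, vs ! s i}"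
      using ends[OF i] red_ends_eq[OF d(1)] by (simp add: s_def m_def)
    moreover have "es ! i = edge_of \<alpha> (\<alpha> d)" "\<alpha> (\<alpha> d) = d" "\<alpha> d \<in> trail_darts"
      using d edge_of_inv inv_inv trail_darts_in trail_darts_inv by auto
    ultimately show "\<exists>x. x \<in> trail_darts \<and> es ! i = edge_of \<alpha> x \<and> apex x = vs ! i \<and> apex (\<alpha> x) = vs ! s i"
      using d by (metis doubleton_eq_iff)
  qed
  then obtain x where x: "\<And>i. i < m \<Longrightarrow> x i \<in> trail_darts" "\<And>i. i < m \<Longrightarrow> es ! i = edge_of \<alpha> (x i)"
      "\<And>i. i < m \<Longrightarrow> apex (x i) = vs ! i" "\<And>i. i < m \<Longrightarrow> apex (\<alpha> (x i)) = vs ! s i"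
    by (metis bchoice lessThan_iff)
  have xD: "x i \<in> D" if "i < m" for i using x(1)[OF that] by (rule trail_darts_in)
  have x_inj: "i = j" if "i < m" "j < m" "edge_of \<alpha> (x i) = edge_of \<alpha> (x j)" for i j
    using that x(2) es(1) by (metis m_def nth_eq_iff_index_eq)
  have x_opp: "x i \<noteq> \<alpha> (x j)" if "i < m" "j < m" for i j
    using x_inj[OF that] edge_of_inv[OF xD[OF that(2)]] inv_neq[OF xD[OF that(2)]] by metis
  \<comment> \<open>Both trail edges have a corner between the common face \<open>f\<close> and the
    same 1-face. As these faces share only one edge, the two corners lie on it, one at each
    end.\<close>
  have "\<forall>i\<in>{..<m}. \<exists>z. z \<in> D \<and> dcol (\<alpha> z) = 1 \<and> {vert z, vert (\<alpha> z)} = {vert (\<alpha> (x i)), vert (x (s i))}"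
  proof
    fix i assume "i \<in> {..<m}"
    then have i: "i < m" by simp
    obtain f where f: "f \<in> faces" "edge_of \<alpha> (x i) \<inter> f \<noteq> {}" "edge_of \<alpha> (x (s i)) \<inter> f \<noteq> {}"
      using common[of i] i x(2)[OF i] x(2)[OF s_lt[of i]] by (auto simp: m_def s_def red_fe_def red_faces_def)
    let ?u = "\<alpha> (x i)" and ?v = "x (s i)"
    have uv: "?u \<in> trail_darts" "?v \<in> trail_darts" using x(1) i s_lt trail_darts_inv by auto
    have fu: "f = face ?u \<or> f = face (\<alpha> ?u)" and fv: "f = face ?v \<or> f = face (\<alpha> ?v)"
      using f faceD[OF f(1)] xD[OF i] by (auto simp: edge_of_def inv_inv)
    obtain z where z: "z \<in> D" "face z = f" "face (\<alpha> z) = apex ?u" "vert ?u \<in> {vert z, vert (\<alpha> z)}"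
      using trail_dart_corner[OF uv(1) fu] .
    obtain z' where z': "z' \<in> D" "face z' = f" "face (\<alpha> z') = apex ?v" "vert ?v \<in> {vert z', vert (\<alpha> z')}"
      using trail_dart_corner[OF uv(2) fv] .
    have "apex ?u = apex ?v" using x(3,4) i s_lt by simp
    then have "z' = z" using common_edge_unique[OF z(1) z'(1)] z z' by simp
    moreover have "vert ?u \<noteq> vert ?v"
      using trail_dart_unique[OF uv] x_opp[OF s_lt i] by metis
    ultimately have "{vert z, vert (\<alpha> z)} = {vert ?u, vert ?v}" using z(4) z'(4) by auto
    moreover have "dcol (\<alpha> z) = 1"
      using z(3) uv(1) trail_darts_iff[of ?u] trail_darts_in by (simp add: apex_def)
    ultimately show "\<exists>z. z \<in> D \<and> dcol (\<alpha> z) = 1 \<and> {vert z, vert (\<alpha> z)} = {vert ?u, vert ?v}"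
      using z(1) by blast
  qed
  then obtain z where z: "\<And>i. i < m \<Longrightarrow> z i \<in> D" "\<And>i. i < m \<Longrightarrow> dcol (\<alpha> (z i)) = 1"
      "\<And>i. i < m \<Longrightarrow> {vert (z i), vert (\<alpha> (z i))} = {vert (\<alpha> (x i)), vert (x (s i))}"
    by (metis bchoice lessThan_iff)
  define L where "L = {y. \<exists>i<m. y = z i \<or> y = \<alpha> (z i)}"
  have L_inv: "\<alpha> y \<in> L" if "y \<in> L" for y
    using that z(1) inv_inv by (auto simp: L_def)
  have LD: "y \<in> D" if "y \<in> L" for y using that z(1) inv_in by (auto simp: L_def)
  have L_inv_iff: "\<alpha> y \<in> L \<longleftrightarrow> y \<in> L" if "y \<in> D" for y
    using L_inv[of y] L_inv[of "\<alpha> y"] inv_inv[OF that] by auto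
  have L_trail: "y \<notin> trail_darts" if "y \<in> L" for y
    using that z(1,2) by (auto simp: L_def trail_darts_def inv_inv)
  have trail_x: "\<exists>i<m. d = x i \<or> d = \<alpha> (x i)" if d: "d \<in> trail_darts" for d
  proof -
    have "edge_of \<alpha> d \<in> set es" using d es(2) by auto
    then obtain i where i: "i < m" "edge_of \<alpha> d = edge_of \<alpha> (x i)"
      using x(2) by (metis in_set_conv_nth m_def)
    have "d \<in> edge_of \<alpha> (x i)" unfolding i(2)[symmetric] by (simp add: edge_of_def)
    then show ?thesis using i(1) by (auto simp: edge_of_def)
  qed
  have touch: "\<exists>i<m. vert d \<in> {vert (z i), vert (\<alpha> (z i))}" if d: "d \<in> trail_darts" for d
  proof -
    obtain i where i: "i < m" "d = x i \<or> d = \<alpha> (x i)" using trail_x[OF d] by auto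
    obtain j where j: "j < m" "s j = i" using s_surj[OF i(1)] by auto
    show ?thesis using i(2)
    proof
      assume "d = x i"
      then have "vert d \<in> {vert (z j), vert (\<alpha> (z j))}" unfolding z(3)[OF j(1)] using j(2) by simp
      then show ?thesis using j(1) by blast
    next
      assume "d = \<alpha> (x i)"
      then have "vert d \<in> {vert (z i), vert (\<alpha> (z i))}" unfolding z(3)[OF i(1)] by simp
      then show ?thesis using i(1) by blast
    qed
  qed
  \<comment> \<open>A vertex on two links would make its only trail dart occur at two places of the
    trail, whose edges are distinct.\<close>
  have touch_unique: "i = j" if d: "d \<in> trail_darts" and ij: "i < m" "j < m"
    and v: "vert d \<in> {vert (z i), vert (\<alpha> (z i))}" "vert d \<in> {vert (z j), vert (\<alpha> (z j))}" for d i j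
  proof -
    have *: "d = \<alpha> (x k) \<or> d = x (s k)" if "k < m" "vert d \<in> {vert (z k), vert (\<alpha> (z k))}" for k
      using that(2) trail_dart_unique[OF d] x(1)[OF that(1)] x(1)[OF s_lt[of k]] trail_darts_inv
      unfolding z(3)[OF that(1)] by auto
    have "d = \<alpha> (x i) \<or> d = x (s i)" "d = \<alpha> (x j) \<or> d = x (s j)" using * ij v by blast+
    moreover have "x (s i) \<noteq> \<alpha> (x j)" "x (s j) \<noteq> \<alpha> (x i)" using x_opp s_lt ij by blast+
    ultimately have "\<alpha> (x i) = \<alpha> (x j) \<or> x (s i) = x (s j)" by metis
    then have "i = j \<or> s i = s j" using x_inj[OF ij] x_inj[OF s_lt s_lt, of i j] inv_eq_iff by metis
    then show ?thesis using s_inj[OF ij] by blast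
  qed
  \<comment> \<open>At the vertex between two successive edges of a 1-face the third edge belongs to
    the trail. A link must end there, so one of the two edges is a link; both being links would make
    them the same edge by \<open>touch_unique\<close>, hence a loop.\<close>
  have alt: "\<sigma> (\<alpha> y) \<in> L \<longleftrightarrow> y \<notin> L" if y: "y \<in> D" "dcol y = 1" for y
  proof -
    let ?e = "\<sigma> (\<alpha> y)"
    let ?d = "\<sigma> ?e"
    have D: "\<alpha> y \<in> D" "?e \<in> D" "?d \<in> D" using y by (auto simp: rot_in inv_in)
    have "\<sigma> (\<sigma> ?d) = ?e" using rot_cycle(4)[OF D(1)] by simp
    then have d: "?d \<in> trail_darts" using trail_darts_iff[OF D(3)] y(2) by (simp add: face_step)
    have vd: "vert ?d = {\<alpha> y, ?e, ?d}" using rot_cycle(5)[OF D(1)] vert_rot by metis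
    have ve: "vert ?e = vert ?d" "vert (\<alpha> y) = vert ?d" by (simp_all add: vert_rot)
    obtain i where i: "i < m" "vert ?d = vert (z i) \<or> vert ?d = vert (\<alpha> (z i))" using touch[OF d] by auto
    then have "z i \<in> vert ?d \<or> \<alpha> (z i) \<in> vert ?d" using vert_self by metis
    then obtain w where w: "w \<in> L" "w \<in> vert ?d" using i(1) by (auto simp: L_def)
    have "w \<noteq> ?d" using w(1) L_trail d by blast
    then have one: "\<alpha> y \<in> L \<or> ?e \<in> L" using w vd by auto
    have "\<not> (\<alpha> y \<in> L \<and> ?e \<in> L)"
    proof
      assume "\<alpha> y \<in> L \<and> ?e \<in> L"
      then obtain i j where i: "i < m" "\<alpha> y = z i \<or> \<alpha> y = \<alpha> (z i)"
        and j: "j < m" "?e = z j \<or> ?e = \<alpha> (z j)" by (auto simp: L_def)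
      have "vert ?d \<in> {vert (z i), vert (\<alpha> (z i))}" "vert ?d \<in> {vert (z j), vert (\<alpha> (z j))}"
        using i(2) j(2) ve by (metis insertI1 insertI2)+
      then have "i = j" using touch_unique[OF d i(1) j(1)] by blast
      moreover have "?e \<noteq> \<alpha> y" using rot_cycle(1)[OF D(1)] .
      ultimately have "?e = \<alpha> (\<alpha> y)" using i j z(1)[OF i(1)] inv_inv by metis
      then have "vert (\<alpha> y) = vert y" using ve inv_inv[OF y(1)] by simp
      then show False using no_loop[OF y(1)] by simp
    qed
    then show ?thesis using one L_inv_iff[OF y(1)] by blast
  qed
  \<comment> \<open>A 1-face joins the region exactly when its links are the edges towards 3-faces,
    for then these separate the region from its complement. Link membership (\<open>alt\<close>) and
    the colour across (\<open>flip\<close>) both alternate along the face, so their equivalence is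
    the same for all of its darts.\<close>
  define S where "S = {d\<in>D. dcol d = 2 \<or> dcol d = 1 \<and> (d \<in> L \<longleftrightarrow> dcol (\<alpha> d) = 3)}"
  have flip: "dcol (\<alpha> (\<sigma> (\<alpha> y))) = 3 \<longleftrightarrow> dcol (\<alpha> y) \<noteq> 3" if y: "y \<in> D" "dcol y = 1" for y
  proof -
    have D: "\<alpha> y \<in> D" "\<sigma> (\<alpha> y) \<in> D" "\<sigma> (\<sigma> (\<alpha> y)) \<in> D" using y by (auto simp: rot_in inv_in)
    show ?thesis
      using dcol_rot_neq[OF D(1)] dcol_cases[OF D(1)] dcol_cases[OF D(3)] y(2)
      by (auto simp: dcol_inv[OF D(2)] face_step)
  qed
  have reg: "region 2 3 S"
    unfolding region_def
  proof (intro conjI ballI impI)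
    fix d assume "d \<in> S"
    then show "\<sigma> (\<alpha> d) \<in> S" using alt[of d] flip[of d]
      by (auto simp: S_def rot_in inv_in face_step)
  qed (auto simp: S_def)
  have trail_bd: "d \<in> boundary S" if "d \<in> trail_darts" for d
    using trail_dart_cols[OF that] trail_darts_in[OF that] by (auto simp: boundary_def S_def inv_in)
  have L_bd: "y \<in> boundary S" if "y \<in> L" for y
  proof -
    have *: "w \<in> boundary S" if w: "w \<in> L" "dcol w = 1" for w
    proof -
      have "dcol (\<alpha> w) = 2 \<or> dcol (\<alpha> w) = 3" "w \<in> D" "\<alpha> w \<in> D"
        using dcol_cases[of "\<alpha> w"] dcol_inv_neq[of w] w LD[OF w(1)] inv_in by auto
      then show ?thesis using w by (auto simp: boundary_def S_def)
    qed
    obtain i where i: "i < m" "y = z i \<or> y = \<alpha> (z i)"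
      using \<open>y \<in> L\<close> by (auto simp: L_def)
    have "\<alpha> (z i) \<in> boundary S" using * z(2)[OF i(1)] i(1) by (auto simp: L_def)
    then show ?thesis using i(2) boundary_inv[of "\<alpha> (z i)" S] inv_inv[OF z(1)[OF i(1)]] by auto
  qed
  \<comment> \<open>It suffices that trail edges and links lie in the boundary, since they already
    connect all vertices in one closed walk.\<close>
  have "dart_connected \<alpha> vert (boundary S) verts"
  proof (rule dart_connectedI)
    show "vert (\<alpha> d) \<in> verts" if "d \<in> boundary S" for d
      using that boundary_subset by (auto intro: vert_in inv_in)
    fix U assume U: "U \<subseteq> verts" "U \<noteq> {}"
      and cl: "\<And>d. d \<in> boundary S \<Longrightarrow> vert d \<in> U \<Longrightarrow> vert (\<alpha> d) \<in> U"
    have xb: "vert (\<alpha> (x i)) \<in> U \<longleftrightarrow> vert (x i) \<in> U" if "i < m" for i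
      using cl[of "x i"] cl[of "\<alpha> (x i)"] trail_bd x(1)[OF that] trail_darts_inv inv_inv[OF xD[OF that]]
      by metis
    have xs: "vert (x (s i)) \<in> U" if i: "i < m" "vert (x i) \<in> U" for i
    proof -
      have "z i \<in> L" "\<alpha> (z i) \<in> L" using i(1) by (auto simp: L_def)
      then have "vert (z i) \<in> U \<longleftrightarrow> vert (\<alpha> (z i)) \<in> U"
        using cl[of "z i"] cl[of "\<alpha> (z i)"] L_bd inv_inv[OF z(1)[OF i(1)]] by metis
      then show ?thesis using z(3)[OF i(1)] xb[OF i(1)] i(2) by (auto simp: doubleton_eq_iff)
    qed
    have rep: "\<exists>i<m. v = vert (x i) \<or> v = vert (\<alpha> (x i))" if "v \<in> verts" for v
      using trail_dart_at_vert[OF that] trail_x by metis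
    obtain u where "u \<in> U" "u \<in> verts" using U by auto
    then obtain i0 where i0: "i0 < m" "vert (x i0) \<in> U" using rep xb by metis
    \<comment> \<open>Membership in \<open>U\<close> spreads along the trail from \<open>i0\<close>;
      index \<open>j\<close> is reached after \<open>j + m - i0\<close> steps, where
      \<open>m\<close> keeps the natural subtraction from truncating.\<close>
    have "vert (x ((i0 + k) mod m)) \<in> U" for k
    proof (induction k)
      case (Suc k)
      have "s ((i0 + k) mod m) = (i0 + Suc k) mod m" by (simp add: s_def mod_Suc_eq)
      then show ?case using xs[OF _ Suc] m2 by simp
    qed (use i0 in simp)
    moreover have "(i0 + (j + m - i0)) mod m = j" if "j < m" for j using that i0(1) by simp
    ultimately have "vert (x j) \<in> U" if "j < m" for j using that by metis
    then show "U = verts" using U(1) rep xb by (metis subsetI subset_antisym)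
  qed
  then show ?thesis using reg by (auto simp: ham_region_def)
qed

text \<open>Follow the boundary with the region on the left, from one edge between a 2-face and a 3-face to
  the next one.\<close>

definition forward_darts :: "'d set" where
  "forward_darts = {d\<in>D. dcol d = 2 \<and> dcol (\<alpha> d) = 3}"

text \<open>The dart \<open>\<sigma> (\<sigma> (\<alpha> d))\<close> belongs to the 1-face at the
  end of \<open>d\<close>. If that face is in the region, the boundary continues between it and the
  3-face; otherwise it continues between it and the 2-face.\<close>

definition link_dart :: "'d set \<Rightarrow> 'd \<Rightarrow> 'd" where
  "link_dart S d = (if \<sigma> (\<sigma> (\<alpha> d)) \<in> S then \<sigma> (\<sigma> (\<alpha> d)) else \<sigma> (\<alpha> d))"

text \<open>The trail dart one link further on. Fixing all other darts makes the map a permutation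
  in the sense of \<open>permutes\<close>, so that the theory of orbits applies.\<close>

definition next_dart :: "'d set \<Rightarrow> 'd \<Rightarrow> 'd" where
  "next_dart S d = (if d \<notin> forward_darts then d
     else if \<sigma> (\<sigma> (\<alpha> d)) \<in> S then \<sigma> (\<sigma> (\<alpha> (\<sigma> (\<sigma> (\<alpha> d))))) else \<sigma> (\<alpha> (\<sigma> (\<alpha> d))))"

lemma forward_trail: "d \<in> forward_darts \<Longrightarrow> d \<in> trail_darts"
  by (auto simp: forward_darts_def trail_darts_def)

text \<open>The first three conclusions are what an A-trail asks of consecutive edges: a trail edge
  again, starting at the 1-face where the last one ended, with a common side. The others say that
  the step follows the boundary along a link.\<close>

lemma next_dart_facts:
  assumes reg: "region 2 3 S" and d: "d \<in> forward_darts"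
  shows "next_dart S d \<in> forward_darts"
    and "apex (next_dart S d) = apex (\<alpha> d)"
    and "face (next_dart S d) = face d \<or> face (\<alpha> (next_dart S d)) = face (\<alpha> d)"
    and "link_dart S d \<in> boundary S" "link_dart S d \<notin> trail_darts"
    and "vert (link_dart S d) = vert (\<alpha> d)" "vert (\<alpha> (link_dart S d)) = vert (next_dart S d)"
proof -
  let ?y = "\<sigma> (\<sigma> (\<alpha> d))" and ?e = "\<sigma> (\<alpha> d)"
  have dD: "d \<in> D" "dcol d = 2" "dcol (\<alpha> d) = 3" using d by (auto simp: forward_darts_def)
  have D: "\<alpha> d \<in> D" "?e \<in> D" "?y \<in> D" "\<alpha> ?y \<in> D" "\<sigma> (\<alpha> ?y) \<in> D" "\<sigma> (\<sigma> (\<alpha> ?y)) \<in> D"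
      "\<alpha> ?e \<in> D" "\<sigma> (\<alpha> ?e) \<in> D"
    using dD by (auto simp: rot_in inv_in)
  have cy: "dcol ?y = 1"
    using trail_darts_iff[OF D(1)] trail_darts_inv[OF forward_trail[OF d]] by simp
  have sy: "\<sigma> ?y = \<alpha> d" using rot_cycle(4)[OF D(1)] .
  have ce: "dcol ?e = 2" using dD by (simp add: face_step)
  have "next_dart S d \<in> forward_darts \<and> apex (next_dart S d) = apex (\<alpha> d) \<and>
      (face (next_dart S d) = face d \<or> face (\<alpha> (next_dart S d)) = face (\<alpha> d)) \<and>
      link_dart S d \<in> boundary S \<and> link_dart S d \<notin> trail_darts \<and>
      vert (link_dart S d) = vert (\<alpha> d) \<and> vert (\<alpha> (link_dart S d)) = vert (next_dart S d)"
  proof (cases "?y \<in> S")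
    case True
    let ?z = "\<sigma> (\<sigma> (\<alpha> ?y))"
    have n: "next_dart S d = ?z" "link_dart S d = ?y" using True d by (auto simp: next_dart_def link_dart_def)
    have fy: "face (\<alpha> ?y) = face (\<alpha> d)" using face_inv[OF D(3)] sy by simp
    have sz: "\<sigma> ?z = \<alpha> ?y" using rot_cycle(4)[OF D(4)] .
    have fz: "face (\<alpha> ?z) = face (\<alpha> d)" using face_inv[OF D(6)] sz fy by simp
    have "dcol ?z = 2"
      using dcol_rot_neq[OF D(4)] dcol_cases[OF D(6)] fy dD(3) cy by (auto simp: face_step)
    then have 1: "?z \<in> forward_darts" using D fz dD(3) by (simp add: forward_darts_def)
    have 2: "apex ?z = apex (\<alpha> d)" using sz by (simp add: apex_def face_step)
    have "\<alpha> d \<notin> S" using reg dD(3) by (auto simp: region_def)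
    then have 3: "?y \<in> boundary S" using boundary_iff[OF reg] True D(3) sy by simp
    have 4: "?y \<notin> trail_darts" using cy by (simp add: trail_darts_def)
    show ?thesis using 1 2 3 4 fz n by (simp add: vert_rot)
  next
    case False
    let ?z = "\<sigma> (\<alpha> ?e)"
    have n: "next_dart S d = ?z" "link_dart S d = ?e" using False d by (auto simp: next_dart_def link_dart_def)
    have 1: "?z \<in> forward_darts"
      using D dD dcol_face_step2[OF dD(1)] by (simp add: forward_darts_def face_step)
    have "\<sigma> (\<sigma> ?z) = \<alpha> ?e" using rot_cycle(4)[OF D(7)] .
    then have 2: "apex ?z = apex (\<alpha> d)" using face_inv[OF D(2)] by (simp add: apex_def)
    have "?e \<in> S" using reg ce D(2) by (auto simp: region_def)
    then have 3: "?e \<in> boundary S" using boundary_iff[OF reg] False D(2) by simp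
    have 4: "?e \<notin> trail_darts" using cy face_inv[OF D(2)] by (simp add: trail_darts_def)
    show ?thesis using 1 2 3 4 n by (simp add: vert_rot face_step)
  qed
  then show "next_dart S d \<in> forward_darts" "apex (next_dart S d) = apex (\<alpha> d)"
    "face (next_dart S d) = face d \<or> face (\<alpha> (next_dart S d)) = face (\<alpha> d)"
    "link_dart S d \<in> boundary S" "link_dart S d \<notin> trail_darts"
    "vert (link_dart S d) = vert (\<alpha> d)" "vert (\<alpha> (link_dart S d)) = vert (next_dart S d)"
    by blast+
qed

text \<open>Injectivity: the image still determines the 1-face passed, whose membership in the
  region tells which branch of the definition was used, and each branch is injective.\<close>

lemma next_dart_permutes:
  assumes reg: "region 2 3 S" shows "next_dart S permutes forward_darts"
proof -
  have fin: "finite forward_darts" using map_facts(1) by (simp add: forward_darts_def)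
  have sub: "next_dart S ` forward_darts \<subseteq> forward_darts" using next_dart_facts(1)[OF reg] by auto
  have inj: "inj_on (next_dart S) forward_darts"
  proof (rule inj_onI)
    fix d d' assume d: "d \<in> forward_darts" "d' \<in> forward_darts" "next_dart S d = next_dart S d'"
    then have "apex (\<alpha> d) = apex (\<alpha> d')" using next_dart_facts(2)[OF reg] by metis
    then have "\<sigma> (\<sigma> (\<alpha> d)) \<in> S \<longleftrightarrow> \<sigma> (\<sigma> (\<alpha> d')) \<in> S" 
      unfolding apex_def by (rule region_face_eq[OF reg])
    then show "d = d'" using d by (auto simp: next_dart_def rot_eq_iff inv_eq_iff split: if_splits)
  qed
  then have "bij_betw (next_dart S) forward_darts forward_darts"
    using endo_inj_surj[OF fin sub inj] by (simp add: bij_betw_def)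
  then show ?thesis by (rule bij_imp_permutes) (simp add: next_dart_def)
qed

lemma boundary_vert_cases:
  assumes "region a b S" "p \<in> boundary S" "q \<in> boundary S" "p \<noteq> q" "vert p = vert q"
    and "x \<in> boundary S" "vert x = vert p"
  shows "x = p \<or> x = q"
proof -
  have pD: "p \<in> D" using assms(2) boundary_subset by auto
  let ?A = "{x\<in>vert p. x \<in> boundary S}"
  have "{p, q} \<subseteq> ?A" "x \<in> ?A" using assms vert_self by auto
  moreover have "finite ?A" "card ?A = 2" using rot_cycle(5)[OF pD] card_boundary_vert[OF assms(1) pD] by auto
  moreover have "card {p, q} = 2" using assms(4) by simp
  ultimately have "{p, q} = ?A" using card_subset_eq by metis
  then show ?thesis using \<open>x \<in> ?A\<close> by blast
qed

text \<open>The end vertices of the darts in the orbit are closed under the boundary: where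
  \<open>d\<close> ends, the boundary darts are \<open>\<alpha> d\<close> and the link to the next
  dart; where it starts, they are \<open>d\<close> and the reversed link from its predecessor. So
  all vertices occur, and as each carries only one trail dart, all forward darts occur.\<close>

lemma forward_dart_orbit:
  assumes S: "ham_region 2 3 S" and d0: "d0 \<in> forward_darts"
  shows "orbit (next_dart S) d0 = forward_darts"
proof -
  have reg: "region 2 3 S" and conn: "dart_connected \<alpha> vert (boundary S) verts"
    using S by (auto simp: ham_region_def)
  let ?O = "orbit (next_dart S) d0"
  note perm = next_dart_permutes[OF reg]
  have fin: "finite forward_darts" using map_facts(1) by (simp add: forward_darts_def)
  then have permu: "permutation (next_dart S)" using perm by (auto simp: permutation_permutes)
  have OF: "?O \<subseteq> forward_darts" using permutes_orbit_subset[OF perm d0] .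
  have self: "d0 \<in> ?O" using permutation_self_in_orbit[OF permu] .
  have trail_bd: "d \<in> boundary S" if "d \<in> trail_darts" for d
    using trail_dart_cols[OF that] trail_darts_in[OF that] reg inv_in[OF trail_darts_in[OF that]]
    by (auto simp: boundary_def region_def)
  let ?U = "vert ` ?O \<union> (\<lambda>d. vert (\<alpha> d)) ` ?O"
  have step: "vert (\<alpha> x) \<in> ?U" if x: "x \<in> boundary S" "vert x \<in> ?U" for x
  proof -
    have xD: "x \<in> D" using x(1) boundary_subset by auto
    from x(2) consider d where "d \<in> ?O" "vert x = vert (\<alpha> d)" | d where "d \<in> ?O" "vert x = vert d" by auto
    then show ?thesis
    proof cases
      case 1
      let ?w = "link_dart S d"
      have dF: "d \<in> forward_darts" using 1 OF by auto
      note nd = next_dart_facts[OF reg dF]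
      have ad: "\<alpha> d \<in> trail_darts" "d \<in> D" using trail_darts_inv forward_trail dF trail_darts_in by auto
      have "x = \<alpha> d \<or> x = ?w"
        using boundary_vert_cases[OF reg trail_bd[OF ad(1)] nd(4)] nd(5,6) ad(1) x(1) 1(2) by metis
      then show ?thesis
      proof
        assume "x = \<alpha> d"
        then show ?thesis using 1(1) ad(2) by (auto simp: inv_inv)
      next
        assume "x = ?w"
        then have "vert (\<alpha> x) = vert (next_dart S d)" using nd(7) by simp
        then show ?thesis using orbit.step[OF 1(1)] by blast
      qed
    next
      case 2
      have "cyclic_on (next_dart S) ?O" using cyclic_on_orbit'[OF permu] .
      moreover obtain d' where d': "d' \<in> forward_darts" "next_dart S d' = d"
        using permutes_image[OF perm] 2(1) OF by (metis imageE subsetD)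
      ultimately have d'O: "d' \<in> ?O" using cyclic_on_f_in[OF perm, of ?O d'] 2(1) by simp
      let ?w = "\<alpha> (link_dart S d')"
      note nd = next_dart_facts[OF reg d'(1)]
      have wD: "link_dart S d' \<in> D" using nd(4) boundary_subset by auto
      have dt: "d \<in> trail_darts" using 2 OF forward_trail by auto
      have wt: "?w \<notin> trail_darts" using nd(5) trail_darts_inv[of ?w] inv_inv[OF wD] by auto
      have "x = d \<or> x = ?w"
        using boundary_vert_cases[OF reg trail_bd[OF dt] boundary_inv[OF nd(4)]] nd(7) d'(2) dt wt x(1) 2(2)
        by metis
      then show ?thesis
      proof
        assume "x = d"
        then show ?thesis using 2(1) by blast
      next
        assume "x = ?w"
        then have "vert (\<alpha> x) = vert (\<alpha> d')" using nd(6) inv_inv[OF wD] by simp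
        then show ?thesis using d'O by blast
      qed
    qed
  qed
  have "d \<in> ?O" if d: "d \<in> forward_darts" for d
  proof -
    have D: "d0 \<in> D" "d \<in> D" using d0 d by (auto simp: forward_darts_def)
    have "vert d \<in> ?U"
      using dart_connected_closed[OF conn vert_in[OF D(1)] _ vert_in[OF D(2)] step] self by blast
    then consider d' where "d' \<in> ?O" "vert d = vert d'" | d' where "d' \<in> ?O" "vert d = vert (\<alpha> d')" by auto
    then show ?thesis
    proof cases
      case 1
      then show ?thesis using trail_dart_unique[of d d'] forward_trail d OF by auto
    next
      case 2
      then have "d' \<in> forward_darts" using OF by auto
      then have "d = \<alpha> d'" using trail_dart_unique[OF forward_trail[OF d] trail_darts_inv[OF forward_trail] 2(2)] by simp
      then show ?thesis using d \<open>d' \<in> forward_darts\<close> by (auto simp: forward_darts_def)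
    qed
  qed
  then show ?thesis using OF by auto
qed

lemma edge_of_forward: "edge_of \<alpha> ` trail_darts = edge_of \<alpha> ` forward_darts"
proof -
  have "edge_of \<alpha> d \<in> edge_of \<alpha> ` forward_darts" if d: "d \<in> trail_darts" for d
  proof -
    have dD: "d \<in> D" using d by (rule trail_darts_in)
    have "d \<in> forward_darts \<or> \<alpha> d \<in> forward_darts"
      using trail_dart_cols[OF d] dD by (auto simp: forward_darts_def inv_in inv_inv)
    then show ?thesis using edge_of_inv[OF dD] by (metis imageI)
  qed
  then show ?thesis using forward_trail by auto
qed

lemma inj_on_edge_of_forward: "inj_on (edge_of \<alpha>) forward_darts"
proof (rule inj_onI)
  fix x y assume xy: "x \<in> forward_darts" "y \<in> forward_darts" "edge_of \<alpha> x = edge_of \<alpha> y"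
  have "x \<in> edge_of \<alpha> y" unfolding xy(3)[symmetric] by (simp add: edge_of_def)
  then show "x = y" using xy(1,2) by (auto simp: edge_of_def forward_darts_def)
qed

text \<open>The trail lists the iterates of \<open>next_dart\<close>. They form a single orbit
  containing every forward dart once, and every edge of the reduced graph has exactly one forward
  dart.\<close>

lemma ham_region_imp_A_trail:
  assumes S: "ham_region 2 3 S"
  shows "reduced_has_A_trail D \<alpha> \<sigma> col 1"
proof -
  have reg: "region 2 3 S" using S by (simp add: ham_region_def)
  obtain d0 where "d0 \<in> D" "dcol d0 = 2" "dcol (\<alpha> d0) = 3"
    using colour_adjacent_dart[of 3 2] by auto
  then have d0: "d0 \<in> forward_darts" by (simp add: forward_darts_def)
  let ?\<rho> = "next_dart S"
  have fin: "finite forward_darts" using map_facts(1) by (simp add: forward_darts_def)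
  then have "permutation ?\<rho>" using next_dart_permutes[OF reg] by (auto simp: permutation_permutes)
  then have self: "d0 \<in> orbit ?\<rho> d0" by (rule permutation_self_in_orbit)
  \<comment> \<open>The first return time of \<open>d0\<close>: the iterates below \<open>m\<close>
    are distinct and exhaust the orbit, and the one at \<open>m\<close> closes the trail.\<close>
  define m where "m = funpow_dist1 ?\<rho> d0 d0"
  define x where "x i = (?\<rho> ^^ i) d0" for i
  have img: "x ` {0..<m} = forward_darts"
    using orbit_conv_funpow_dist1[OF self] forward_dart_orbit[OF S d0] by (simp add: x_def m_def)
  have inj: "inj_on x {0..<m}"
    using inj_on_funpow_dist1[OF self] by (simp add: x_def[abs_def] m_def)
  have m0: "m > 0" by (simp add: m_def)
  have xm: "x m = d0" using funpow_dist1_prop[OF self] by (simp add: x_def m_def)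
  have xF: "x i \<in> forward_darts" if "i < m" for i using that img by auto
  have nxt: "x ((i + 1) mod m) = ?\<rho> (x i)" if "i < m" for i
  proof (cases "Suc i = m")
    case True
    then have "?\<rho> (x i) = d0" using xm by (auto simp: x_def)
    then show ?thesis using True by (simp add: x_def)
  next
    case False
    then show ?thesis using that by (simp add: x_def)
  qed
  let ?es = "map (\<lambda>i. edge_of \<alpha> (x i)) [0..<m]" and ?vs = "map (\<lambda>i. apex (x i)) [0..<m]"
  have "is_A_trail (red_verts D \<alpha> \<sigma> col 1) (red_edges D \<alpha> \<sigma> col 1)
      (red_ends D \<alpha> \<sigma> col 1) (red_faces D \<alpha> \<sigma> col 1) (red_fe D \<alpha> \<sigma> col 1) ?es ?vs"
    unfolding is_A_trail_def Let_def
  proof (intro conjI allI impI)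
    show "0 < length ?es" "length ?vs = length ?es" using m0 by simp_all
    have "inj_on (edge_of \<alpha> \<circ> x) {0..<m}"
      using inj inj_on_edge_of_forward img by (simp add: comp_inj_on)
    then show "distinct ?es" by (simp add: distinct_map comp_def)
    have "set ?es = edge_of \<alpha> ` x ` {0..<m}" by (simp add: image_image)
    then show "set ?es = red_edges D \<alpha> \<sigma> col 1" by (simp only: img red_edges_eq edge_of_forward)
    show "set ?vs \<subseteq> red_verts D \<alpha> \<sigma> col 1"
    proof
      fix X assume "X \<in> set ?vs"
      then obtain i where i: "i < m" "X = apex (x i)" by auto
      then have t: "x i \<in> trail_darts" using xF forward_trail by auto
      then have "dcol (\<sigma> (\<sigma> (x i))) = 1" "\<sigma> (\<sigma> (x i)) \<in> D"
        using trail_darts_iff trail_darts_in rot_in by blast+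
      then show "X \<in> red_verts D \<alpha> \<sigma> col 1" using i(2) face_in by (auto simp: red_verts_def apex_def)
    qed
    fix i assume "i < length ?es"
    then have i: "i < m" by simp
    let ?j = "(i + 1) mod m"
    have j: "?j < m" using m0 by simp
    have nth: "?es ! i = edge_of \<alpha> (x i)" "?vs ! i = apex (x i)"
        "?es ! ((i + 1) mod length ?es) = edge_of \<alpha> (x ?j)" "?vs ! ((i + 1) mod length ?es) = apex (x ?j)"
      using i j by simp_all
    note nd = next_dart_facts[OF reg xF[OF i]]
    show "red_ends D \<alpha> \<sigma> col 1 (?es ! i) = {?vs ! i, ?vs ! ((i + 1) mod length ?es)}"
      unfolding nth nxt[OF i] nd(2) using red_ends_eq[OF forward_trail[OF xF[OF i]]] .
    have fe: "red_fe D \<alpha> \<sigma> col 1 (face y) (edge_of \<alpha> z)" if "z \<in> trail_darts" "y = z \<or> y = \<alpha> z" for y z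
      using that face_self[of y] unfolding red_fe_def red_edges_eq by (auto simp: edge_of_def)
    have rf: "face y \<in> red_faces D \<alpha> \<sigma> col 1" if "y \<in> trail_darts" for y
      using that face_in by (auto simp: red_faces_def trail_darts_def)
    have t: "x i \<in> trail_darts" "x ?j \<in> trail_darts" using xF i j forward_trail by auto
    have sh: "face (x ?j) = face (x i) \<or> face (\<alpha> (x ?j)) = face (\<alpha> (x i))"
      using nd(3) nxt[OF i] by simp
    show "\<exists>f\<in>red_faces D \<alpha> \<sigma> col 1. red_fe D \<alpha> \<sigma> col 1 f (?es ! i) \<and>
        red_fe D \<alpha> \<sigma> col 1 f (?es ! ((i + 1) mod length ?es))"
      unfolding nth using sh
    proof
      assume "face (x ?j) = face (x i)"
      then show "\<exists>f\<in>red_faces D \<alpha> \<sigma> col 1. red_fe D \<alpha> \<sigma> col 1 f (edge_of \<alpha> (x i)) \<and>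
          red_fe D \<alpha> \<sigma> col 1 f (edge_of \<alpha> (x ?j))"
        using fe[OF t(1), of "x i"] fe[OF t(2), of "x ?j"] rf[OF t(1)] by metis
    next
      assume "face (\<alpha> (x ?j)) = face (\<alpha> (x i))"
      then show "\<exists>f\<in>red_faces D \<alpha> \<sigma> col 1. red_fe D \<alpha> \<sigma> col 1 f (edge_of \<alpha> (x i)) \<and>
          red_fe D \<alpha> \<sigma> col 1 f (edge_of \<alpha> (x ?j))"
        using fe[OF t(1), of "\<alpha> (x i)"] fe[OF t(2), of "\<alpha> (x ?j)"] rf[OF trail_darts_inv[OF t(1)]] by metis
    qed
  qed
  then show ?thesis by (auto simp: reduced_has_A_trail_def has_A_trail_def)
qed

end

theorem theorem2:
  fixes D :: "'d set" and \<alpha> \<sigma> :: "'d \<Rightarrow> 'd"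
    and col :: "'d set \<Rightarrow> nat" and outer :: "'d set"
  assumes "barnette D \<alpha> \<sigma>"
    and "proper_face_3_coloring D \<alpha> \<sigma> col"
    and "outer \<in> map_faces D \<alpha> \<sigma>"
    and "col outer = 3"
  shows "((\<exists>C. ham_cycle D \<alpha> \<sigma> C \<and>
             (\<forall>F\<in>map_faces D \<alpha> \<sigma>. col F = 2 \<longrightarrow> F \<notin> outside_faces D \<alpha> \<sigma> C outer) \<and>
             (\<forall>F\<in>map_faces D \<alpha> \<sigma>. col F = 3 \<longrightarrow> F \<in> outside_faces D \<alpha> \<sigma> C outer))
          \<longleftrightarrow> reduced_has_A_trail D \<alpha> \<sigma> col 1)
       \<and> (reduced_has_A_trail D \<alpha> \<sigma> col 1 \<longleftrightarrow> reduced_has_sptf D \<alpha> \<sigma> col outer 2 1)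
       \<and> (reduced_has_sptf D \<alpha> \<sigma> col outer 2 1 \<longleftrightarrow> reduced_has_sptf D \<alpha> \<sigma> col outer 3 1)"
proof -
  interpret coloured_barnette D \<alpha> \<sigma> col by unfold_locales (fact assms)+
  have "reduced_has_A_trail D \<alpha> \<sigma> col 1 \<longleftrightarrow> (\<exists>S. ham_region 2 3 S)"
    using A_trail_imp_ham_region ham_region_imp_A_trail by blast
  moreover have "reduced_has_sptf D \<alpha> \<sigma> col outer 2 1 \<longleftrightarrow> (\<exists>S. ham_region 2 3 S)"
    by (rule reduced_has_sptf_iff_ham_region[OF assms(4)]) simp
  moreover have "reduced_has_sptf D \<alpha> \<sigma> col outer 3 1 \<longleftrightarrow> (\<exists>S. ham_region 3 2 S)"
    by (rule reduced_has_sptf_iff_ham_region[OF assms(4)]) auto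
  moreover have "(\<exists>S. ham_region 2 3 S) \<longleftrightarrow> (\<exists>S. ham_region 3 2 S)"
    using ham_region_complement by blast
  ultimately show ?thesis using ham_cycle_iff_ham_region[OF assms(3,4)] by simp
qed

end
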